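(* Let $d\ge1$, let $\nu$ be a number of degrees of freedom and $\Psi$ a positive definite $d\times d$ scale matrix, and let $G=\mathrm{IW}(\nu,\Psi)$ be the inverse-Wishart distribution on $d\times d$ positive definite matrices. Then there exist positive constants $a_2,a_3,a_4,a_5,b_2,b_3,b_4,C_2,C_3$ such that, with $\kappa=2$: (i) $G\{\Sigma:\mathrm{eig}_d(\Sigma^{-1})\ge x\}\le b_2\exp(-C_2x^{a_2})$ for all sufficiently large $x>0$; (ii) $G\{\Sigma:\mathrm{eig}_1(\Sigma^{-1})<x\}\le b_3x^{a_3}$ for all sufficiently small $x>0$; (iii) for all $0<s_1\le\cdots\le s_d$ and all $t\in(0,1)$, $$G\{\Sigma:s_j<\mathrm{eig}_j(\Sigma^{-1})<s_j(1+t),\ j=1,\ldots,d\}\ge b_4\,s_1^{a_4}t^{a_5}\exp(-C_3s_d^{\kappa/2}).$$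
   Context: For a $d\times d$ matrix $A$ with real eigenvalues, $\mathrm{eig}_1(A)\le\cdots\le\mathrm{eig}_d(A)$ denote its ordered eigenvalues. $\Sigma\sim\mathrm{IW}(\nu,\Psi)$ means that $\Sigma^{-1}$ has the (nonsingular) Wishart distribution with $\nu$ degrees of freedom, $\nu>d-1$, and scale matrix $\Psi^{-1}$. *)

theory Defs
  imports
    "HOL-Probability.Probability"
    "HOL-Computational_Algebra.Polynomial"
begin

definition posdef :: "real^'n^'n \<Rightarrow> bool" where
  "posdef A \<longleftrightarrow> transpose A = A \<and> (\<forall>x. x \<noteq> 0 \<longrightarrow> x \<bullet> (A *v x) > 0)"

definition charpoly :: "real^'n^'n \<Rightarrow> real poly" where
  "charpoly A = det (mat [:0, 1:] - (\<chi> i j. [:A $ i $ j:]))"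

text \<open>Eigenvalues are counted with algebraic multiplicity, and \<open>j\<close> runs over \<open>1..CARD('n)\<close>.
  Only real roots are listed, so this is meaningful when all eigenvalues of \<open>A\<close> are real.\<close>

definition eig :: "nat \<Rightarrow> real^'n^'n \<Rightarrow> real" where
  "eig j A = sorted_list_of_multiset (proots (charpoly A)) ! (j - 1)"

text \<open>Lebesgue measure \<open>\<Prod>\<^bsub>i \<le> j\<^esub> dS\<^bsub>ij\<^esub>\<close> on the symmetric matrices: the free entries are indexed by
  the unordered pairs \<open>{i, j}\<close>, with \<open>i = j\<close> allowed, so no order on the index type is needed.\<close>

definition sym_lborel :: "(real^'n^'n) measure" where
  "sym_lborel =
     distr (\<Pi>\<^sub>M p\<in>{{i, j} | i j :: 'n. True}. (lborel :: real measure)) borel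
       (\<lambda>f. \<chi> i j. f {i, j})"

text \<open>The multivariate gamma function of dimension \<open>d\<close>.\<close>

definition mv_Gamma :: "nat \<Rightarrow> real \<Rightarrow> real" where
  "mv_Gamma d a =
     pi powr (real d * (real d - 1) / 4) * (\<Prod>j = 1..d. Gamma (a + (1 - real j) / 2))"

text \<open>For \<open>\<nu> > d - 1\<close> and \<open>V\<close> positive definite; the normalization is such that the mean is \<open>\<nu> V\<close>.\<close>

definition wishart_density :: "real \<Rightarrow> real^'n^'n \<Rightarrow> real^'n^'n \<Rightarrow> real" where
  "wishart_density \<nu> V S =
     (let d = real CARD('n) in
        det S powr ((\<nu> - d - 1) / 2) * exp (- trace (matrix_inv V ** S) / 2) /
        (2 powr (\<nu> * d / 2) * det V powr (\<nu> / 2) * mv_Gamma CARD('n) (\<nu> / 2)))"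

definition wishart :: "real \<Rightarrow> real^'n^'n \<Rightarrow> (real^'n^'n) measure" where
  "wishart \<nu> V =
     density (restrict_space sym_lborel {S. posdef S}) (\<lambda>S. ennreal (wishart_density \<nu> V S))"

definition inv_wishart :: "real \<Rightarrow> real^'n^'n \<Rightarrow> (real^'n^'n) measure" where
  "inv_wishart \<nu> \<Psi> =
     distr (wishart \<nu> (matrix_inv \<Psi>)) (restrict_space borel {\<Sigma>. posdef \<Sigma>}) matrix_inv"

end

theory Submission
  imports Defs
begin

text \<open>
  The variable \<open>S = \<Sigma>\<inverse>\<close> has a density proportional to \<open>(det S) powr e * exp (- trace (\<Psi> ** S) / 2)\<close> with
  \<open>e = (\<nu> - d - 1) / 2 > -1\<close>, and \<open>trace (\<Psi> ** S)\<close> is comparable to \<open>trace S\<close>. Everything rests on the finiteness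
  of the integral of \<open>(det S) powr e * exp (- c * trace S)\<close> over the positive definite cone for all \<open>e > -1\<close>, \<open>c > 0\<close>.
  For \<open>e > 0\<close> the determinant is absorbed by the exponential. For \<open>-1 < e \<le> 0\<close> one integrates out the
  diagonal entries one by one: the determinant is affine in a diagonal entry, with the complementary principal
  minor as slope, so each step produces the same integrand for a smaller principal minor.

  Since \<open>eig\<^sub>d S \<le> trace S\<close>, the upper tail is exponential. Since \<open>det S \<le> eig\<^sub>1 S * trace S ^ (d - 1)\<close>, a small
  first eigenvalue costs a power \<open>(det S) powr (- \<delta>)\<close>, which is still integrable. For the window bound, Weyl's
  inequality shows that a cube of side of order \<open>s\<^sub>1 t\<close> around the diagonal matrix with entries \<open>s\<^sub>j (1 + t / 2)\<close> lies
  in the event, and the density is bounded below on that cube.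
\<close>

subsection \<open>Spectral theory of symmetric matrices\<close>

lemma symmetric_inner:
  fixes A :: "real^'n^'n"
  assumes "transpose A = A"
  shows "x \<bullet> (A *v y) = (A *v x) \<bullet> y"
  by (metis assms dot_lmul_matrix transpose_matrix_vector)

text \<open>First-order optimality: near \<open>t = 0\<close> the linear term dominates, so a
  nonzero \<open>b\<close> would make the expression negative on one side.\<close>

lemma quadratic_form_nonneg_linear_zero:
  fixes b c :: real
  assumes "\<And>t. 0 \<le> 2 * t * b + t\<^sup>2 * c"
  shows "b = 0"
proof (rule ccontr)
  assume "b \<noteq> 0"
  \<comment> \<open>The minimizer after replacing \<open>c\<close> by
    \<open>\<bar>c\<bar> + 1\<close>, a majorant whose leading coefficient is positive whatever the
    sign of \<open>c\<close>.\<close>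
  define t where "t = - b / (\<bar>c\<bar> + 1)"
  have "2 * t * b + t\<^sup>2 * c \<le> 2 * t * b + t\<^sup>2 * (\<bar>c\<bar> + 1)"
    by (intro add_left_mono mult_left_mono) auto
  also have "\<dots> = - b\<^sup>2 / (\<bar>c\<bar> + 1)"
  proof -
    have "(\<bar>c\<bar> + 1) * t = - b" by (simp add: t_def)
    then have "t * ((\<bar>c\<bar> + 1) * t) = t * (- b)" by simp
    then have "2 * t * b + t\<^sup>2 * (\<bar>c\<bar> + 1) = t * b" by (simp add: power2_eq_square algebra_simps)
    then show ?thesis by (simp add: t_def power2_eq_square)
  qed
  also have "\<dots> < 0" using \<open>b \<noteq> 0\<close> by (simp add: divide_neg_pos)
  finally show False using assms[of t] by simp
qed

text \<open>The eigenvector maximizes the Rayleigh quotient on the orthogonal complement of \<open>B\<close>; the complement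
  is invariant because \<open>B\<close> consists of eigenvectors.\<close>

lemma symmetric_eigenvector_orthogonal:
  fixes A :: "real^'n^'n"
  assumes sym: "transpose A = A" and fin: "finite B" and card: "card B < CARD('n)"
    and eigB: "\<And>b. b \<in> B \<Longrightarrow> \<exists>l. A *v b = l *\<^sub>R b"
  obtains v l where "norm v = 1" "\<And>b. b \<in> B \<Longrightarrow> b \<bullet> v = 0" "A *v v = l *\<^sub>R v"
proof -
  define S where "S = {x. \<forall>b\<in>B. b \<bullet> x = 0}"
  have subS: "subspace S" unfolding S_def subspace_def by (auto simp: inner_add_right)
  have "dim B < DIM(real^'n)" using dim_le_card'[OF fin] card by simp
  then obtain u where u: "u \<noteq> 0" "\<And>y. y \<in> span B \<Longrightarrow> orthogonal u y"
    using orthogonal_to_subspace_exists by blast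
  have uS: "u \<in> S"
    using u(2)[OF span_base] by (auto simp: S_def orthogonal_def inner_commute)
  define K where "K = S \<inter> sphere 0 1"
  have clS: "closed S" using subS by (rule closed_subspace)
  have "compact K" unfolding K_def by (intro closed_Int_compact clS compact_sphere)
  moreover have "(1 / norm u) *\<^sub>R u \<in> K"
    using uS u(1) subspace_scale[OF subS uS] unfolding K_def by auto
  then have "K \<noteq> {}" by auto
  moreover have "continuous_on K (\<lambda>x. x \<bullet> (A *v x))" by (intro continuous_intros)
  ultimately obtain v where v: "v \<in> K" and vmax: "\<And>x. x \<in> K \<Longrightarrow> x \<bullet> (A *v x) \<le> v \<bullet> (A *v v)"
    using continuous_attains_sup[of K "\<lambda>x. x \<bullet> (A *v x)"] by blast
  define l where "l = v \<bullet> (A *v v)"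
  have vS: "v \<in> S" and nv: "norm v = 1" using v by (auto simp: K_def)
  have vv: "v \<bullet> v = 1" using nv by (simp add: norm_eq_1)
  have ray: "x \<bullet> (A *v x) \<le> l * (x \<bullet> x)" if "x \<in> S" for x
  proof (cases "x = 0")
    case False
    have "(1 / norm x) *\<^sub>R x \<in> K"
      using that False subspace_scale[OF subS that] unfolding K_def by auto
    from vmax[OF this] have "(x \<bullet> (A *v x)) / (norm x)\<^sup>2 \<le> l"
      by (simp add: l_def matrix_vector_mult_scaleR power2_eq_square)
    then show ?thesis using False by (simp add: field_simps power2_norm_eq_inner)
  qed auto
  have AS: "A *v x \<in> S" if "x \<in> S" for x
  proof -
    have "b \<bullet> (A *v x) = 0" if bB: "b \<in> B" for b
    proof -
      obtain m where "A *v b = m *\<^sub>R b" using eigB[OF bB] by auto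
      then show ?thesis using symmetric_inner[OF sym, of b x] bB \<open>x \<in> S\<close> by (simp add: S_def)
    qed
    then show ?thesis by (simp add: S_def)
  qed
  \<comment> \<open>The residual of the eigenvalue equation. Along \<open>v + t *\<^sub>R w\<close>
    the Rayleigh inequality has linear coefficient \<open>w \<bullet> w\<close>, so maximality of
    \<open>v\<close> forces the residual to vanish.\<close>
  define w where "w = l *\<^sub>R v - A *v v"
  have wS: "w \<in> S" unfolding w_def by (intro subspace_diff subspace_scale subS AS vS)
  have "w \<bullet> w = 0"
  proof (rule quadratic_form_nonneg_linear_zero)
    fix t :: real
    have "v + t *\<^sub>R w \<in> S" by (intro subspace_add subspace_scale subS vS wS)
    from ray[OF this]
    have "0 \<le> l * ((v + t *\<^sub>R w) \<bullet> (v + t *\<^sub>R w)) - (v + t *\<^sub>R w) \<bullet> (A *v (v + t *\<^sub>R w))" by simp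
    also have "\<dots> = 2 * t * (w \<bullet> w) + t\<^sup>2 * (l * (w \<bullet> w) - w \<bullet> (A *v w))"
    proof -
      have 1: "v \<bullet> (A *v w) = w \<bullet> (A *v v)"
        using symmetric_inner[OF sym, of v w] by (simp add: inner_commute)
      have "w \<bullet> w = l * (w \<bullet> v) - w \<bullet> (A *v v)"
        by (subst (2) w_def) (simp add: inner_diff_right)
      then have 2: "w \<bullet> (A *v v) = l * (w \<bullet> v) - w \<bullet> w" by simp
      show ?thesis
        by (simp add: matrix_vector_right_distrib matrix_vector_mult_scaleR inner_add_left inner_add_right
            1 2 inner_commute[of v w] vv l_def[symmetric] power2_eq_square algebra_simps)
    qed
    finally show "0 \<le> 2 * t * (w \<bullet> w) + t\<^sup>2 * (l * (w \<bullet> w) - w \<bullet> (A *v w))" .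
  qed
  then have "A *v v = l *\<^sub>R v" by (simp add: w_def)
  with that nv vS show thesis by (auto simp: S_def)
qed

text \<open>Each induction step adjoins a unit eigenvector orthogonal to the earlier ones, which
  exists as long as fewer than \<open>CARD('n)\<close> have been chosen.\<close>

lemma symmetric_orthonormal_eigenvectors:
  fixes A :: "real^'n^'n"
  assumes sym: "transpose A = A" and "k \<le> CARD('n)"
  shows "\<exists>B. finite B \<and> card B = k \<and> (\<forall>b\<in>B. \<forall>c\<in>B. b \<bullet> c = (if b = c then 1 else 0)) \<and>
    (\<forall>b\<in>B. \<exists>l. A *v b = l *\<^sub>R b)"
  using assms(2)
proof (induction k)
  case (Suc k)
  then obtain B where B: "finite B" "card B = k" "\<forall>b\<in>B. \<forall>c\<in>B. b \<bullet> c = (if b = c then 1 else 0)"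
    "\<forall>b\<in>B. \<exists>l. A *v b = l *\<^sub>R b" by auto
  obtain v l where v: "norm v = 1" "\<And>b. b \<in> B \<Longrightarrow> b \<bullet> v = 0" "A *v v = l *\<^sub>R v"
    using symmetric_eigenvector_orthogonal[OF sym B(1)] B Suc.prems by (metis Suc_le_lessD)
  have "v \<notin> B" using v B(3) by (metis inner_eq_zero_iff norm_zero zero_neq_one)
  with B v show ?case
    by (intro exI[of _ "insert v B"]) (auto simp: inner_commute norm_eq_1)
qed (auto intro: exI[of _ "{}"])

text \<open>The family is indexed by \<open>'n\<close> itself, without any order on the eigenvalues,
  so that the vectors form the columns of a square matrix of the same type as
  \<open>A\<close>.\<close>

definition eigenbasis :: "real^'n^'n \<Rightarrow> ('n \<Rightarrow> real^'n) \<Rightarrow> ('n \<Rightarrow> real) \<Rightarrow> bool" where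
  "eigenbasis A v l \<longleftrightarrow>
    (\<forall>i j. v i \<bullet> v j = (if i = j then 1 else 0)) \<and> (\<forall>i. A *v v i = l i *\<^sub>R v i)"

lemma symmetric_eigenbasis:
  fixes A :: "real^'n^'n"
  assumes sym: "transpose A = A"
  obtains v l where "eigenbasis A v l"
proof -
  obtain B where B: "finite B" "card B = CARD('n)" "\<forall>b\<in>B. \<forall>c\<in>B. b \<bullet> c = (if b = c then 1 else 0)"
    "\<forall>b\<in>B. \<exists>l. A *v b = l *\<^sub>R b"
    using symmetric_orthonormal_eigenvectors[OF sym order_refl] by auto
  then obtain v where v: "bij_betw v (UNIV::'n set) B"
    by (metis finite_same_card_bij finite_class.finite_UNIV)
  have vB: "v i \<in> B" for i using v by (auto simp: bij_betw_def)
  have "\<forall>i. \<exists>l. A *v v i = l *\<^sub>R v i" using B(4) vB by blast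
  then obtain l where l: "\<And>i. A *v v i = l i *\<^sub>R v i" by metis
  have "v i = v j \<longleftrightarrow> i = j" for i j using v by (auto simp: bij_betw_def inj_on_def)
  then have "eigenbasis A v l" using B(3) vB l by (auto simp: eigenbasis_def)
  then show thesis by (rule that)
qed

text \<open>Polymorphic in the entries because it is used both over the reals and over real
  polynomials.\<close>

definition diagmat :: "('n \<Rightarrow> 'a::zero) \<Rightarrow> 'a^'n^'n" where
  "diagmat l = (\<chi> i j. if i = j then l i else 0)"

lemma matrix_mul_diagmat: "(U ** diagmat l :: 'a::semiring_1^'n^'n) $ i $ j = U $ i $ j * l j"
proof -
  have "(U ** diagmat l) $ i $ j = (\<Sum>k\<in>UNIV. if k = j then U $ i $ j * l j else 0)"
    unfolding matrix_matrix_mult_def diagmat_def vec_lambda_beta by (intro sum.cong) auto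
  then show ?thesis by simp
qed

lemma diagmat_matrix_mul: "(diagmat l ** U :: 'a::semiring_1^'n^'n) $ i $ j = l i * U $ i $ j"
proof -
  have "(diagmat l ** U) $ i $ j = (\<Sum>k\<in>UNIV. if k = i then l i * U $ i $ j else 0)"
    unfolding matrix_matrix_mult_def diagmat_def vec_lambda_beta by (intro sum.cong) auto
  then show ?thesis by simp
qed

lemma det_diagmat: "det (diagmat l :: 'a::comm_ring_1^'n^'n) = prod l UNIV"
  by (subst det_diagonal) (auto simp: diagmat_def)

lemma eigenbasis_matrix:
  fixes A :: "real^'n^'n"
  assumes "eigenbasis A v l"
  defines "U \<equiv> \<chi> i j. v j $ i"
  shows "transpose U ** U = mat 1" "U ** transpose U = mat 1" "A ** U = U ** diagmat l"
proof -
  show 1: "transpose U ** U = mat 1"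
    using assms(1)
    by (simp add: vec_eq_iff matrix_matrix_mult_def transpose_def mat_def U_def eigenbasis_def inner_vec_def)
  then show "U ** transpose U = mat 1" by (simp add: matrix_left_right_inverse)
  have "(A ** U) $ i $ j = (U ** diagmat l) $ i $ j" for i j
  proof -
    have "(A ** U) $ i $ j = (A *v v j) $ i"
      by (simp add: matrix_matrix_mult_def matrix_vector_mult_def U_def)
    also have "\<dots> = l j * v j $ i" using assms(1) by (simp add: eigenbasis_def)
    finally show ?thesis by (simp add: matrix_mul_diagmat U_def)
  qed
  then show "A ** U = U ** diagmat l" by (simp add: vec_eq_iff)
qed

text \<open>With \<open>A = U ** diagmat l ** transpose U\<close>, cyclicity of the trace conjugates
  \<open>P\<close> instead of \<open>A\<close>; the diagonal entries of
  \<open>transpose U ** P ** U\<close> are the values of the form of \<open>P\<close> at the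
  eigenvectors.\<close>

lemma trace_mult_eigenbasis:
  fixes A P :: "real^'n^'n"
  assumes "eigenbasis A v l"
  shows "trace (P ** A) = (\<Sum>i\<in>UNIV. l i * (v i \<bullet> (P *v v i)))"
proof -
  define U :: "real^'n^'n" where "U = (\<chi> i j. v j $ i)"
  note U = eigenbasis_matrix[OF assms, folded U_def]
  have "P ** A = P ** (A ** U) ** transpose U"
    using U(2) by (simp add: matrix_mul_assoc[symmetric])
  then have "trace (P ** A) = trace (transpose U ** (P ** (U ** diagmat l)))"
    unfolding U(3) by (metis trace_mul_sym)
  also have "\<dots> = trace ((transpose U ** (P ** U)) ** diagmat l)"
    by (simp add: matrix_mul_assoc)
  also have "\<dots> = (\<Sum>i\<in>UNIV. (transpose U ** (P ** U)) $ i $ i * l i)"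
    by (simp add: trace_def matrix_mul_diagmat)
  finally have "trace (P ** A) = (\<Sum>i\<in>UNIV. (transpose U ** (P ** U)) $ i $ i * l i)" .
  moreover have "(transpose U ** (P ** U)) $ i $ i = v i \<bullet> (P *v v i)" for i
    by (simp add: matrix_matrix_mult_def transpose_def U_def inner_vec_def matrix_vector_mult_def)
  ultimately show ?thesis by (simp add: mult.commute)
qed

lemma trace_eigenbasis:
  fixes A :: "real^'n^'n"
  assumes "eigenbasis A v l"
  shows "trace A = sum l UNIV"
  using trace_mult_eigenbasis[OF assms, of "mat 1"] assms by (simp add: eigenbasis_def)

lemma det_eigenbasis:
  fixes A :: "real^'n^'n"
  assumes "eigenbasis A v l"
  shows "det A = prod l UNIV"
proof -
  define U :: "real^'n^'n" where "U = (\<chi> i j. v j $ i)"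
  note U = eigenbasis_matrix[OF assms, folded U_def]
  have "det (transpose U) * det U = 1" using U(1) by (metis det_I det_mul)
  moreover have "det A * det U = det U * prod l UNIV"
    using U(3) by (metis det_diagmat det_mul)
  ultimately show ?thesis by auto
qed

section \<open>Characteristic polynomial and ordered eigenvalues\<close>

definition const_poly_mat :: "real^'n^'n \<Rightarrow> real poly^'n^'n" where
  "const_poly_mat A = (\<chi> i j. [:A $ i $ j:])"

lemma const_poly_mat_mult:
  fixes A B :: "real^'n^'n"
  shows "const_poly_mat (A ** B) = const_poly_mat A ** const_poly_mat B"
proof -
  have "(\<Sum>i\<in>S. [:f i:]) = [:sum f S:]" for f :: "'n \<Rightarrow> real" and S
    by (induction S rule: infinite_finite_induct) auto
  then show ?thesis
    by (simp add: const_poly_mat_def matrix_matrix_mult_def vec_eq_iff mult.commute)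
qed

text \<open>Similarity invariance, carried out over the polynomial ring: the scalar matrix commutes
  with everything, and the image of \<open>U\<close> has nonzero determinant because it still has a
  left inverse, so that determinant cancels.\<close>

lemma charpoly_eigenbasis:
  fixes A :: "real^'n^'n"
  assumes "eigenbasis A v l"
  shows "charpoly A = (\<Prod>i\<in>UNIV. [:- l i, 1:])"
proof -
  define U :: "real^'n^'n" where "U = (\<chi> i j. v j $ i)"
  note U = eigenbasis_matrix[OF assms, folded U_def]
  let ?X = "mat [:0, 1:] :: real poly^'n^'n"
  let ?c = const_poly_mat
  have XC: "?X ** M = M ** ?X" for M
  proof -
    have X: "?X = diagmat (\<lambda>_. [:0, 1:])" by (simp add: mat_def diagmat_def)
    show ?thesis unfolding X vec_eq_iff by (simp add: diagmat_matrix_mul matrix_mul_diagmat)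
  qed
  have c1: "?c (mat 1) = mat 1"
    by (auto simp: const_poly_mat_def mat_def vec_eq_iff one_pCons)
  have "?c (transpose U) ** ?c U = mat 1" using U(1) c1 by (metis const_poly_mat_mult)
  then have ne: "det (?c U) \<noteq> 0"
    by (metis det_I det_mul mult_zero_right zero_neq_one)
  have "(?X - ?c A) ** ?c U = ?X ** ?c U - ?c A ** ?c U"
    by (simp add: matrix_matrix_mult_def vec_eq_iff left_diff_distrib sum_subtractf)
  also have "\<dots> = ?c U ** ?X - ?c U ** ?c (diagmat l)"
    using U(3) by (simp add: XC const_poly_mat_mult[symmetric])
  also have "\<dots> = ?c U ** (?X - ?c (diagmat l))"
    by (simp add: matrix_matrix_mult_def vec_eq_iff right_diff_distrib sum_subtractf)
  finally have "det (?X - ?c A) * det (?c U) = det (?c U) * det (?X - ?c (diagmat l))"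
    by (metis det_mul)
  with ne have "det (?X - ?c A) = det (?X - ?c (diagmat l))" by simp
  also have "?X - ?c (diagmat l) = diagmat (\<lambda>i. [:- l i, 1:])"
    by (auto simp: vec_eq_iff mat_def const_poly_mat_def diagmat_def)
  finally show ?thesis by (simp add: charpoly_def const_poly_mat_def det_diagmat)
qed

lemma proots_charpoly_eigenbasis:
  fixes A :: "real^'n^'n"
  assumes "eigenbasis A v l"
  shows "proots (charpoly A) = image_mset l (mset_set UNIV)"
proof -
  have "(\<Sum>i\<in>S. {#l i#}) = image_mset l (mset_set S)" for S
    by (induction S rule: infinite_finite_induct) auto
  then show ?thesis
    unfolding charpoly_eigenbasis[OF assms] by (subst proots_prod) auto
qed

text \<open>A sorted list is determined by its multiset, so any increasing enumeration of the
  \<open>l i\<close> must agree with the list behind \<open>eig\<close>.\<close>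

lemma eig_eq_sorted:
  fixes A :: "real^'n^'n"
  assumes A: "eigenbasis A v l" and b: "bij_betw b {1..CARD('n)} UNIV"
    and mono: "\<And>i j. 1 \<le> i \<Longrightarrow> i \<le> j \<Longrightarrow> j \<le> CARD('n) \<Longrightarrow> l (b i) \<le> l (b j)"
    and j: "j \<in> {1..CARD('n)}"
  shows "eig j A = l (b j)"
proof -
  define xs where "xs = map (\<lambda>j. l (b j)) [1..<CARD('n) + 1]"
  have "mset_set (UNIV :: 'n set) = image_mset b (mset_set {1..CARD('n)})"
    using b by (metis bij_betw_def image_mset_mset_set)
  then have "proots (charpoly A) = mset xs"
    unfolding proots_charpoly_eigenbasis[OF A] xs_def
    by (simp add: multiset.map_comp comp_def atLeastLessThanSuc_atLeastAtMost del: upt_Suc)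
  moreover have "sorted xs"
    unfolding sorted_iff_nth_mono xs_def using mono by (simp add: nth_upt del: upt_Suc)
  ultimately have "sorted_list_of_multiset (proots (charpoly A)) = xs"
    by (simp add: sorted_list_of_multiset_mset sort_key_id_if_sorted)
  then have "eig j A = xs ! (j - 1)" by (simp only: eig_def)
  also have "\<dots> = l (b ([1..<CARD('n) + 1] ! (j - 1)))" unfolding xs_def using j by (intro nth_map) auto
  \<comment> \<open>List positions start at 0 while \<open>eig\<close> counts from 1, hence the
    shift.\<close>
  also have "[1..<CARD('n) + 1] ! (j - 1) = j" using j by (subst nth_upt) auto
  finally show ?thesis .
qed

text \<open>Sorting the indices by \<open>l\<close> supplies the enumeration for
  \<open>eig_eq_sorted\<close>; through it, facts about an unordered eigenbasis pass to
  \<open>eig\<close>.\<close>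

lemma eig_enumeration:
  fixes A :: "real^'n^'n"
  assumes A: "eigenbasis A v l"
  obtains b where "bij_betw b {1..CARD('n)} UNIV" "\<And>j. j \<in> {1..CARD('n)} \<Longrightarrow> eig j A = l (b j)"
    "\<And>i j. 1 \<le> i \<Longrightarrow> i \<le> j \<Longrightarrow> j \<le> CARD('n) \<Longrightarrow> eig i A \<le> eig j A"
proof -
  obtain ns :: "'n list" where ns: "set ns = UNIV" "distinct ns"
    using finite_distinct_list[of "UNIV :: 'n set"] by auto
  define zs where "zs = sort_key l ns"
  have zs: "set zs = UNIV" "distinct zs" "sorted (map l zs)" using ns by (auto simp: zs_def)
  have len: "length zs = CARD('n)" using zs by (metis distinct_card)
  define b where "b = (\<lambda>j. zs ! (j - 1))"
  have "bij_betw (\<lambda>j::nat. j - 1) {1..CARD('n)} {..<CARD('n)}"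
    by (rule bij_betwI[where g = Suc]) auto
  moreover have "bij_betw (\<lambda>j. zs ! j) {..<CARD('n)} UNIV"
    using bij_betw_nth[OF zs(2), of "{..<CARD('n)}" UNIV] len zs by simp
  ultimately have b: "bij_betw b {1..CARD('n)} UNIV"
    using bij_betw_trans unfolding b_def comp_def by fastforce
  have mono: "l (b i) \<le> l (b j)" if "1 \<le> i" "i \<le> j" "j \<le> CARD('n)" for i j
    using zs(3) that len unfolding sorted_iff_nth_mono b_def by auto
  note e = eig_eq_sorted[OF A b mono]
  show thesis using that[OF b e] mono e by simp
qed

lemma eig_spectral:
  fixes A :: "real^'n^'n"
  assumes sym: "transpose A = A"
  obtains v where "\<And>i j. i \<in> {1..CARD('n)} \<Longrightarrow> j \<in> {1..CARD('n)} \<Longrightarrow> v i \<bullet> v j = (if i = j then 1 else 0)"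
    "\<And>j. j \<in> {1..CARD('n)} \<Longrightarrow> A *v v j = eig j A *\<^sub>R v j"
proof -
  obtain v l where vl: "eigenbasis A v l" using symmetric_eigenbasis[OF sym] .
  obtain b where b: "bij_betw b {1..CARD('n)} UNIV" "\<And>j. j \<in> {1..CARD('n)} \<Longrightarrow> eig j A = l (b j)"
    using eig_enumeration[OF vl] by metis
  show thesis
  proof (rule that[of "\<lambda>j. v (b j)"])
    fix i j assume "i \<in> {1..CARD('n)}" "j \<in> {1..CARD('n)}"
    then have "b i = b j \<longleftrightarrow> i = j" using b(1) by (metis bij_betw_def inj_on_eq_iff)
    then show "v (b i) \<bullet> v (b j) = (if i = j then 1 else 0)"
      using vl by (simp add: eigenbasis_def)
  next
    fix j assume "j \<in> {1..CARD('n)}"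
    then show "A *v v (b j) = eig j A *\<^sub>R v (b j)" using vl b(2) by (simp add: eigenbasis_def)
  qed
qed

lemma eig_mono:
  fixes A :: "real^'n^'n"
  assumes "transpose A = A" "1 \<le> i" "i \<le> j" "j \<le> CARD('n)"
  shows "eig i A \<le> eig j A"
  using assms symmetric_eigenbasis eig_enumeration by metis

lemma trace_eq_sum_eig:
  fixes A :: "real^'n^'n"
  assumes "transpose A = A"
  shows "trace A = (\<Sum>j=1..CARD('n). eig j A)"
proof -
  obtain v l where vl: "eigenbasis A v l" using symmetric_eigenbasis[OF assms] .
  obtain b where b: "bij_betw b {1..CARD('n)} UNIV" "\<And>j. j \<in> {1..CARD('n)} \<Longrightarrow> eig j A = l (b j)"
    using eig_enumeration[OF vl] by metis
  show ?thesis unfolding trace_eigenbasis[OF vl] using sum.reindex_bij_betw[OF b(1), of l] b(2) by simp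
qed

lemma det_eq_prod_eig:
  fixes A :: "real^'n^'n"
  assumes "transpose A = A"
  shows "det A = (\<Prod>j=1..CARD('n). eig j A)"
proof -
  obtain v l where vl: "eigenbasis A v l" using symmetric_eigenbasis[OF assms] .
  obtain b where b: "bij_betw b {1..CARD('n)} UNIV" "\<And>j. j \<in> {1..CARD('n)} \<Longrightarrow> eig j A = l (b j)"
    using eig_enumeration[OF vl] by metis
  show ?thesis unfolding det_eigenbasis[OF vl] using prod.reindex_bij_betw[OF b(1), of l] b(2) by simp
qed

text \<open>Both forms are expressed in the same orthonormal coordinates \<open>c\<close>, so on the
  span the Rayleigh quotient is a weighted average of the \<open>l i\<close>.\<close>

lemma span_orthonormal_eigen:
  fixes A :: "real^'n^'n"
  assumes fin: "finite I"
    and orth: "\<And>i j. i \<in> I \<Longrightarrow> j \<in> I \<Longrightarrow> v i \<bullet> v j = (if i = j then 1 else 0)"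
    and eig: "\<And>j. j \<in> I \<Longrightarrow> A *v v j = l j *\<^sub>R v j"
  shows "dim (span (v ` I)) = card I"
    and "x \<in> span (v ` I) \<Longrightarrow>
      \<exists>c. x \<bullet> x = (\<Sum>i\<in>I. (c i)\<^sup>2) \<and> x \<bullet> (A *v x) = (\<Sum>i\<in>I. l i * (c i)\<^sup>2)"
proof -
  have inj: "inj_on v I"
    using orth by (intro inj_onI) (metis zero_neq_one)
  have "independent (v ` I)"
  proof (rule pairwise_orthogonal_independent)
    show "pairwise orthogonal (v ` I)"
      using orth by (auto simp: pairwise_def orthogonal_def)
    show "0 \<notin> v ` I" using orth by (metis imageE inner_zero_left zero_neq_one)
  qed
  then show "dim (span (v ` I)) = card I"
    using dim_span_eq_card_independent card_image[OF inj] by metis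
  assume "x \<in> span (v ` I)"
  then obtain u where "x = (\<Sum>a\<in>v ` I. u a *\<^sub>R a)"
    using span_finite[of "v ` I"] fin by auto
  then have x: "x = (\<Sum>i\<in>I. u (v i) *\<^sub>R v i)" by (simp add: sum.reindex[OF inj])
  have Ax: "A *v x = (\<Sum>i\<in>I. (l i * u (v i)) *\<^sub>R v i)"
    unfolding x using eig
    by (simp add: linear_sum[OF matrix_vector_mul_linear] matrix_vector_mult_scaleR mult.commute)
  have ip: "(\<Sum>i\<in>I. f i *\<^sub>R v i) \<bullet> (\<Sum>i\<in>I. g i *\<^sub>R v i) = (\<Sum>i\<in>I. f i * g i)" for f g
  proof -
    have "(\<Sum>i\<in>I. f i *\<^sub>R v i) \<bullet> (\<Sum>i\<in>I. g i *\<^sub>R v i) = (\<Sum>i\<in>I. \<Sum>j\<in>I. if j = i then f i * g i else 0)"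
      unfolding inner_sum_left inner_sum_right
      using orth by (intro sum.cong) (auto simp: mult.commute)
    then show ?thesis using fin by simp
  qed
  show "\<exists>c. x \<bullet> x = (\<Sum>i\<in>I. (c i)\<^sup>2) \<and> x \<bullet> (A *v x) = (\<Sum>i\<in>I. l i * (c i)\<^sup>2)"
  proof (intro exI conjI)
    show "x \<bullet> x = (\<Sum>i\<in>I. (u (v i))\<^sup>2)" unfolding x ip by (simp add: power2_eq_square)
    show "x \<bullet> (A *v x) = (\<Sum>i\<in>I. l i * (u (v i))\<^sup>2)"
      unfolding Ax by (subst x, subst ip) (simp add: power2_eq_square mult_ac)
  qed
qed

text \<open>Courant-Fischer argument: the top \<open>d - j + 1\<close> eigenvectors of \<open>A\<close> and the bottom \<open>j\<close> eigenvectors of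
  \<open>B\<close> span subspaces that meet nontrivially.\<close>

lemma eig_le_perturb:
  fixes A B :: "real^'n^'n"
  assumes A: "transpose A = A" and B: "transpose B = B"
    and le: "\<And>x. x \<bullet> (A *v x) \<le> x \<bullet> (B *v x) + e * (x \<bullet> x)"
    and j: "j \<in> {1..CARD('n)}"
  shows "eig j A \<le> eig j B + e"
proof -
  let ?d = "CARD('n)"
  obtain v where v: "\<And>i j. i \<in> {1..?d} \<Longrightarrow> j \<in> {1..?d} \<Longrightarrow> v i \<bullet> v j = (if i = j then 1 else 0)"
    "\<And>j. j \<in> {1..?d} \<Longrightarrow> A *v v j = eig j A *\<^sub>R v j" using eig_spectral[OF A] by metis
  obtain w where w: "\<And>i j. i \<in> {1..?d} \<Longrightarrow> j \<in> {1..?d} \<Longrightarrow> w i \<bullet> w j = (if i = j then 1 else 0)"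
    "\<And>j. j \<in> {1..?d} \<Longrightarrow> B *v w j = eig j B *\<^sub>R w j" using eig_spectral[OF B] by metis
  define V where "V = span (v ` {j..?d})"
  define W where "W = span (w ` {1..j})"
  have V: "dim V = ?d - j + 1"
    "\<And>x. x \<in> V \<Longrightarrow> \<exists>c. x \<bullet> x = (\<Sum>i=j..?d. (c i)\<^sup>2) \<and> x \<bullet> (A *v x) = (\<Sum>i=j..?d. eig i A * (c i)\<^sup>2)"
    unfolding V_def
    using span_orthonormal_eigen[of "{j..?d}" v A "\<lambda>i. eig i A"] v j by auto
  have W: "dim W = j"
    "\<And>x. x \<in> W \<Longrightarrow> \<exists>c. x \<bullet> x = (\<Sum>i=1..j. (c i)\<^sup>2) \<and> x \<bullet> (B *v x) = (\<Sum>i=1..j. eig i B * (c i)\<^sup>2)"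
    unfolding W_def
    using span_orthonormal_eigen[of "{1..j}" w B "\<lambda>i. eig i B"] w j by auto
  \<comment> \<open>The dimensions \<open>d - j + 1\<close> and \<open>j\<close> add up to
    \<open>d + 1\<close>, one more than the ambient space allows for independent subspaces.\<close>
  have "dim {x + y |x y. x \<in> V \<and> y \<in> W} + dim (V \<inter> W) = dim V + dim W"
    by (rule dim_sums_Int) (auto simp: V_def W_def)
  moreover have "dim {x + y |x y. x \<in> V \<and> y \<in> W} \<le> ?d" by (rule dim_subset_UNIV_cart)
  ultimately have "dim (V \<inter> W) > 0" using V(1) W(1) j by auto
  then obtain x where x: "x \<in> V" "x \<in> W" "x \<noteq> 0"
    by (metis Int_iff dim_eq_0 insertI1 less_irrefl subsetI)
  obtain c where c: "x \<bullet> x = (\<Sum>i=j..?d. (c i)\<^sup>2)" "x \<bullet> (A *v x) = (\<Sum>i=j..?d. eig i A * (c i)\<^sup>2)"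
    using V(2)[OF x(1)] by auto
  obtain b where b: "x \<bullet> x = (\<Sum>i=1..j. (b i)\<^sup>2)" "x \<bullet> (B *v x) = (\<Sum>i=1..j. eig i B * (b i)\<^sup>2)"
    using W(2)[OF x(2)] by auto
  \<comment> \<open>On \<open>V\<close> only eigenvalues of \<open>A\<close> with index at least
    \<open>j\<close> enter, and on \<open>W\<close> only eigenvalues of \<open>B\<close> with index
    at most \<open>j\<close>.\<close>
  have "eig j A * (x \<bullet> x) \<le> x \<bullet> (A *v x)"
    unfolding c sum_distrib_left using eig_mono[OF A] j by (intro sum_mono mult_right_mono) auto
  also note le
  also have "x \<bullet> (B *v x) \<le> eig j B * (x \<bullet> x)"
    unfolding b sum_distrib_left using eig_mono[OF B] j by (intro sum_mono mult_right_mono) auto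
  finally have "eig j A * (x \<bullet> x) \<le> (eig j B + e) * (x \<bullet> x)" by (simp add: algebra_simps)
  then show ?thesis using x(3) by (simp add: mult_le_cancel_right)
qed

subsection \<open>Positive definite matrices\<close>

lemma posdef_symmetric: "posdef A \<Longrightarrow> transpose A = A"
  by (simp add: posdef_def)

lemma eig_1_quadratic_form:
  fixes A :: "real^'n^'n"
  assumes sym: "transpose A = A"
  shows "eig 1 A * (x \<bullet> x) \<le> x \<bullet> (A *v x)"
proof -
  obtain v where v: "\<And>i j. i \<in> {1..CARD('n)} \<Longrightarrow> j \<in> {1..CARD('n)} \<Longrightarrow> v i \<bullet> v j = (if i = j then 1 else 0)"
    "\<And>j. j \<in> {1..CARD('n)} \<Longrightarrow> A *v v j = eig j A *\<^sub>R v j" using eig_spectral[OF sym] by metis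
  note s = span_orthonormal_eigen[of "{1..CARD('n)}" v A "\<lambda>i. eig i A", OF _ v, simplified]
  have "span (v ` {1..CARD('n)}) = UNIV"
    using s(1) dim_eq_full[of "v ` {1..CARD('n)}"] by simp
  then obtain c where c: "x \<bullet> x = (\<Sum>i=1..CARD('n). (c i)\<^sup>2)" "x \<bullet> (A *v x) = (\<Sum>i=1..CARD('n). eig i A * (c i)\<^sup>2)"
    using s(2)[of x] by auto
  show ?thesis
    unfolding c sum_distrib_left using eig_mono[OF sym] by (intro sum_mono mult_right_mono) auto
qed

lemma posdef_eig_pos:
  fixes A :: "real^'n^'n"
  assumes A: "posdef A" and j: "j \<in> {1..CARD('n)}"
  shows "eig j A > 0"
proof -
  obtain v where v: "\<And>i j. i \<in> {1..CARD('n)} \<Longrightarrow> j \<in> {1..CARD('n)} \<Longrightarrow> v i \<bullet> v j = (if i = j then 1 else 0)"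
    "\<And>j. j \<in> {1..CARD('n)} \<Longrightarrow> A *v v j = eig j A *\<^sub>R v j" 
    using eig_spectral[OF posdef_symmetric[OF A]] by metis
  have "v j \<noteq> 0" using v(1)[OF j j] by auto
  then have "v j \<bullet> (A *v v j) > 0" using A by (auto simp: posdef_def)
  then show ?thesis using v(1)[OF j j] v(2)[OF j] by simp
qed

text \<open>Reduces membership in the cone to a single eigenvalue, which yields both its
  measurability and the positivity test in the window bound.\<close>

lemma posdef_iff_eig_1:
  fixes A :: "real^'n^'n"
  shows "posdef A \<longleftrightarrow> transpose A = A \<and> eig 1 A > 0"
proof
  assume "transpose A = A \<and> eig 1 A > 0"
  then show "posdef A" unfolding posdef_def
    using eig_1_quadratic_form[of A]
    by (metis inner_gt_zero_iff less_le_trans mult_pos_pos)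
qed (simp add: posdef_symmetric posdef_eig_pos)

lemma posdef_det_pos:
  fixes A :: "real^'n^'n"
  assumes "posdef A"
  shows "det A > 0"
  unfolding det_eq_prod_eig[OF posdef_symmetric[OF assms]]
  using posdef_eig_pos[OF assms] by (intro prod_pos) auto

lemma posdef_trace_pos:
  fixes A :: "real^'n^'n"
  assumes "posdef A"
  shows "trace A > 0"
  unfolding trace_eq_sum_eig[OF posdef_symmetric[OF assms]]
  using posdef_eig_pos[OF assms] by (intro sum_pos) auto

lemma posdef_eig_le_trace:
  fixes A :: "real^'n^'n"
  assumes "posdef A" "j \<in> {1..CARD('n)}"
  shows "eig j A \<le> trace A"
  unfolding trace_eq_sum_eig[OF posdef_symmetric[OF assms(1)]]
  using posdef_eig_pos[OF assms(1)] assms(2) by (intro member_le_sum) (auto intro: less_imp_le)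

text \<open>All eigenvalues are positive, so each factor other than the first is at most the trace.
  Keeping the first factor converts a small smallest eigenvalue into a small determinant.\<close>

lemma posdef_det_le:
  fixes A :: "real^'n^'n"
  assumes A: "posdef A"
  shows "det A \<le> eig 1 A * trace A ^ (CARD('n) - 1)"
proof -
  have "det A = eig 1 A * (\<Prod>j\<in>{1..CARD('n)} - {1}. eig j A)"
    unfolding det_eq_prod_eig[OF posdef_symmetric[OF A]] by (subst prod.remove[of _ 1]) (auto simp: Suc_leI)
  also have "(\<Prod>j\<in>{1..CARD('n)} - {1}. eig j A) \<le> (\<Prod>j\<in>{1..CARD('n)} - {1}. trace A)"
    using posdef_eig_pos[OF A] posdef_eig_le_trace[OF A] by (intro prod_mono) (auto intro: less_imp_le)
  also have "\<dots> = trace A ^ (CARD('n) - 1)" by (simp add: card_Diff_singleton Suc_leI)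
  finally show ?thesis using posdef_eig_pos[OF A, of 1] by (simp add: Suc_leI)
qed

lemma posdef_det_le_trace_power:
  fixes A :: "real^'n^'n"
  assumes A: "posdef A"
  shows "det A \<le> trace A ^ CARD('n)"
proof -
  have "det A \<le> eig 1 A * trace A ^ (CARD('n) - 1)" by (rule posdef_det_le[OF A])
  also have "\<dots> \<le> trace A * trace A ^ (CARD('n) - 1)"
    using posdef_eig_le_trace[OF A, of 1] posdef_trace_pos[OF A]
    by (intro mult_right_mono) (auto simp: Suc_leI)
  also have "\<dots> = trace A ^ CARD('n)" by (simp add: power_eq_if)
  finally show ?thesis .
qed

lemma quadratic_form_sum:
  fixes A :: "real^'n^'n"
  shows "x \<bullet> (A *v y) = (\<Sum>i\<in>UNIV. \<Sum>j\<in>UNIV. x $ i * A $ i $ j * y $ j)"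
  by (simp add: inner_vec_def matrix_vector_mult_def sum_distrib_left mult.assoc)

lemma axis_quadratic_form:
  fixes A :: "real^'n^'n"
  shows "axis i 1 \<bullet> (A *v axis j 1) = A $ i $ j"
  by (simp add: matrix_vector_mult_basis inner_axis' column_def)

text \<open>Testing the form on the sum and the difference of two basis vectors bounds twice an
  off-diagonal entry by two diagonal ones. Exponential decay in the trace thereby becomes decay in
  every coordinate.\<close>

lemma posdef_abs_entry_le_trace:
  fixes A :: "real^'n^'n"
  assumes A: "posdef A"
  shows "\<bar>A $ i $ j\<bar> \<le> trace A"
proof -
  have pos: "x \<bullet> (A *v x) \<ge> 0" for x using A by (cases "x = 0") (auto simp: posdef_def less_imp_le)
  have diag: "A $ k $ k \<ge> 0" for k using pos[of "axis k 1"] by (simp add: axis_quadratic_form)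
  have sym: "A $ j $ i = A $ i $ j" using posdef_symmetric[OF A] by (metis transpose_def vec_lambda_beta)
  show ?thesis
  proof (cases "i = j")
    case True
    then show ?thesis
      unfolding trace_def using diag member_le_sum[of j UNIV "\<lambda>k. A $ k $ k"] by simp
  next
    case False
    have "A $ i $ i + A $ j $ j = (\<Sum>k\<in>{i, j}. A $ k $ k)" using False by simp
    also have "\<dots> \<le> trace A" unfolding trace_def using diag by (intro sum_mono2) auto
    finally have 1: "A $ i $ i + A $ j $ j \<le> trace A" .
    have "0 \<le> A $ i $ i + A $ j $ j + 2 * A $ i $ j"
      using pos[of "axis i 1 + axis j 1"] sym
      by (simp add: matrix_vector_right_distrib inner_add_left inner_add_right axis_quadratic_form)
    moreover have "0 \<le> A $ i $ i + A $ j $ j - 2 * A $ i $ j"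
      using pos[of "axis i 1 - axis j 1"] sym
      by (simp add: matrix_vector_mult_diff_distrib inner_diff_left inner_diff_right axis_quadratic_form)
    ultimately show ?thesis using 1 by linarith
  qed
qed

text \<open>The constant is the smallest eigenvalue of \<open>P\<close>. Diagonalizing
  \<open>S\<close> rather than \<open>P\<close> writes the trace as a sum of positive weights times
  values of the form of \<open>P\<close> at unit vectors.\<close>

lemma trace_mult_posdef_lower:
  fixes P :: "real^'n^'n"
  assumes P: "posdef P"
  obtains c where "c > 0" "\<And>S. posdef S \<Longrightarrow> c * trace S \<le> trace (P ** S)"
proof
  show "eig 1 P > 0" using P by (simp add: posdef_iff_eig_1)
  fix S :: "real^'n^'n" assume S: "posdef S"
  obtain v l where vl: "eigenbasis S v l" using symmetric_eigenbasis[OF posdef_symmetric[OF S]] .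
  have v: "v i \<bullet> v i = 1" "S *v v i = l i *\<^sub>R v i" for i using vl by (auto simp: eigenbasis_def)
  have "v i \<noteq> 0" for i using v(1)[of i] by auto
  then have "0 < v i \<bullet> (S *v v i)" for i using S by (auto simp: posdef_def)
  then have l: "l i > 0" for i using v by simp
  have "eig 1 P * trace S = (\<Sum>i\<in>UNIV. l i * (eig 1 P * (v i \<bullet> v i)))"
    unfolding trace_eigenbasis[OF vl] sum_distrib_left by (simp add: v mult.commute)
  also have "\<dots> \<le> (\<Sum>i\<in>UNIV. l i * (v i \<bullet> (P *v v i)))"
    using eig_1_quadratic_form[OF posdef_symmetric[OF P]] l
    by (intro sum_mono mult_left_mono) (auto intro: less_imp_le)
  finally show "eig 1 P * trace S \<le> trace (P ** S)" by (simp add: trace_mult_eigenbasis[OF vl])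
qed

text \<open>Every entry of \<open>S\<close> is at most the trace in absolute value, so the sum of
  the absolute entries of \<open>P\<close> works; adding 1 makes the constant strictly
  positive.\<close>

lemma trace_mult_posdef_upper:
  fixes P :: "real^'n^'n"
  obtains C where "C > 0" "\<And>S. posdef S \<Longrightarrow> trace (P ** S) \<le> C * trace S"
proof
  let ?C = "(\<Sum>i\<in>UNIV. \<Sum>j\<in>UNIV. \<bar>P $ i $ j\<bar>) + 1"
  show "?C > 0" by (intro add_nonneg_pos sum_nonneg) auto
  fix S :: "real^'n^'n" assume S: "posdef S"
  have "trace (P ** S) = (\<Sum>i\<in>UNIV. \<Sum>j\<in>UNIV. P $ i $ j * S $ j $ i)"
    by (simp add: trace_def matrix_matrix_mult_def)
  also have "\<dots> \<le> (\<Sum>i\<in>UNIV. \<Sum>j\<in>UNIV. \<bar>P $ i $ j\<bar> * trace S)"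
  proof (intro sum_mono)
    fix i j
    have "P $ i $ j * S $ j $ i \<le> \<bar>P $ i $ j\<bar> * \<bar>S $ j $ i\<bar>" by (metis abs_ge_self abs_mult)
    also have "\<dots> \<le> \<bar>P $ i $ j\<bar> * trace S"
      using posdef_abs_entry_le_trace[OF S] by (intro mult_left_mono) auto
    finally show "P $ i $ j * S $ j $ i \<le> \<bar>P $ i $ j\<bar> * trace S" .
  qed
  also have "\<dots> \<le> ?C * trace S"
    using posdef_trace_pos[OF S] by (simp add: sum_distrib_right sum_distrib_left algebra_simps)
  finally show "trace (P ** S) \<le> ?C * trace S" .
qed

section \<open>Inverses of positive definite matrices\<close>

lemma matrix_inv_unique:
  fixes A B :: "real^'n^'n"
  assumes "A ** B = mat 1"
  shows "matrix_inv A = B"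
proof -
  have BA: "B ** A = mat 1" using assms by (simp add: matrix_left_right_inverse)
  have "A ** matrix_inv A = mat 1 \<and> matrix_inv A ** A = mat 1"
    unfolding matrix_inv_def by (rule someI[of _ B]) (use assms BA in auto)
  then show ?thesis using BA by (metis matrix_mul_assoc matrix_mul_lid matrix_mul_rid)
qed

lemma posdef_matrix_inv:
  fixes A :: "real^'n^'n"
  assumes A: "posdef A"
  shows "A ** matrix_inv A = mat 1" "posdef (matrix_inv A)" "matrix_inv (matrix_inv A) = A"
proof -
  have "invertible A" using posdef_det_pos[OF A] by (simp add: invertible_det_nz)
  then obtain B where B: "A ** B = mat 1" "B ** A = mat 1" by (auto simp: invertible_def)
  note inv = matrix_inv_unique[OF B(1)] matrix_inv_unique[OF B(2)]
  show "A ** matrix_inv A = mat 1" "matrix_inv (matrix_inv A) = A" using B inv by auto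
  have "A ** transpose B = mat 1"
    using B(2) posdef_symmetric[OF A] by (metis matrix_transpose_mul transpose_mat)
  then have sym: "transpose B = B" using matrix_inv_unique inv by metis
  have "x \<bullet> (B *v x) > 0" if "x \<noteq> 0" for x
  proof -
    \<comment> \<open>The form of the inverse at \<open>x\<close> equals the form of
      \<open>A\<close> at \<open>B *v x\<close>.\<close>
    have x: "A *v (B *v x) = x" using B by (simp add: matrix_vector_mul_assoc)
    then have "B *v x \<noteq> 0" using that by auto
    then have "(B *v x) \<bullet> (A *v (B *v x)) > 0" using A by (auto simp: posdef_def)
    then show ?thesis using x by (simp add: inner_commute)
  qed
  then show "posdef (matrix_inv A)" using sym inv by (simp add: posdef_def)
qed

text \<open>A matrix with entries of size at most \<open>r\<close> has operator norm at most
  \<open>d\<^sup>2 * r\<close>, where \<open>d = CARD('n)\<close>. The two matrices therefore differ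
  by at most this multiple of the identity as quadratic forms, and \<open>eig_le_perturb\<close>
  applies in both directions.\<close>

lemma eig_Lipschitz_entries:
  fixes A B :: "real^'n^'n"
  assumes A: "transpose A = A" and B: "transpose B = B"
    and le: "\<And>i j. \<bar>A $ i $ j - B $ i $ j\<bar> \<le> r" and j: "j \<in> {1..CARD('n)}"
  shows "\<bar>eig j A - eig j B\<bar> \<le> (real CARD('n))\<^sup>2 * r"
proof -
  have q: "x \<bullet> (M *v x) \<le> (real CARD('n))\<^sup>2 * r * (x \<bullet> x)"
    if M: "\<And>i j. \<bar>M $ i $ j\<bar> \<le> r" for M :: "real^'n^'n" and x
  proof -
    have "x \<bullet> (M *v x) \<le> norm x * norm (M *v x)" by (rule norm_cauchy_schwarz)
    also have "\<dots> \<le> norm x * (onorm ((*v) M) * norm x)"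
      by (intro mult_left_mono onorm matrix_vector_mul_bounded_linear) auto
    also have "\<dots> \<le> norm x * ((real CARD('n) * real CARD('n) * r) * norm x)"
      by (intro mult_left_mono mult_right_mono onorm_le_matrix_component M) auto
    finally show ?thesis by (simp add: power2_eq_square power2_norm_eq_inner[symmetric] mult_ac)
  qed
  have "x \<bullet> (A *v x) \<le> x \<bullet> (B *v x) + (real CARD('n))\<^sup>2 * r * (x \<bullet> x)" for x
    using q[of "A - B" x] le by (simp add: matrix_vector_mult_diff_rdistrib inner_diff_right)
  moreover have "x \<bullet> (B *v x) \<le> x \<bullet> (A *v x) + (real CARD('n))\<^sup>2 * r * (x \<bullet> x)" for x
    using q[of "B - A" x] le
    by (simp add: matrix_vector_mult_diff_rdistrib inner_diff_right abs_minus_commute)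
  ultimately have "eig j A \<le> eig j B + (real CARD('n))\<^sup>2 * r" "eig j B \<le> eig j A + (real CARD('n))\<^sup>2 * r"
    using eig_le_perturb A B j by blast+
  then show ?thesis by linarith
qed

section \<open>Borel measurability of the eigenvalues, the cone and the inverse\<close>

lemma closed_symmetric: "closed {A :: real^'n^'n. transpose A = A}"
proof -
  have "{A :: real^'n^'n. transpose A = A} = {A. \<forall>i j. A $ j $ i = A $ i $ j}"
    by (simp add: vec_eq_iff transpose_def)
  also have "closed \<dots>"
    by (intro closed_Collect_all closed_Collect_eq continuous_intros)
  finally show ?thesis .
qed

lemma continuous_on_eig:
  assumes j: "j \<in> {1..CARD('n)}"
  shows "continuous_on {A :: real^'n^'n. transpose A = A} (eig j)"
  unfolding continuous_on_iff
proof (intro ballI allI impI)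
  fix A :: "real^'n^'n" and e :: real
  assume A: "A \<in> {A. transpose A = A}" and e: "e > 0"
  \<comment> \<open>The factor 2 makes the final estimate strict.\<close>
  define r where "r = e / (2 * (real CARD('n))\<^sup>2)"
  have "r > 0" using e by (simp add: r_def)
  moreover have "dist (eig j B) (eig j A) < e" if B: "B \<in> {A. transpose A = A}" "dist B A < r" for B
  proof -
    have "\<bar>B $ i $ k - A $ i $ k\<bar> \<le> r" for i k
    proof -
      have "\<bar>(B - A) $ i $ k\<bar> \<le> norm ((B - A) $ i)" by (rule component_le_norm_cart)
      also have "\<dots> \<le> norm (B - A)" by (rule Finite_Cartesian_Product.norm_nth_le)
      finally show ?thesis using B by (simp add: dist_norm)
    qed
    from eig_Lipschitz_entries[OF _ _ this j] have "\<bar>eig j B - eig j A\<bar> \<le> (real CARD('n))\<^sup>2 * r"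
      using A B by simp
    also have "\<dots> < e" using e by (simp add: r_def)
    finally show ?thesis by (simp add: dist_norm)
  qed
  ultimately show "\<exists>d>0. \<forall>B\<in>{A. transpose A = A}. dist B A < d \<longrightarrow> dist (eig j B) (eig j A) < e"
    by blast
qed

text \<open>Continuity is available on the symmetric matrices, a closed set, so extending by 0
  outside it gives a Borel function on the whole space.\<close>

lemma measurable_eig_if_symmetric [measurable]:
  assumes "j \<in> {1..CARD('n)}"
  shows "(\<lambda>A :: real^'n^'n. if transpose A = A then eig j A else 0) \<in> borel_measurable borel"
  using borel_measurable_continuous_on_if[OF _ continuous_on_eig[OF assms], of "\<lambda>_. 0"] borel_closed[OF closed_symmetric]
  by simp

lemma borel_posdef [measurable]: "{A :: real^'n^'n. posdef A} \<in> sets borel"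
proof -
  have "{A :: real^'n^'n. posdef A} = {A \<in> space borel. (if transpose A = A then eig 1 A else 0) > 0}"
    by (auto simp: posdef_iff_eig_1 split: if_splits)
  also have "\<dots> \<in> sets borel"
    using measurable_eig_if_symmetric[of 1, where 'n='n] by measurable
  finally show ?thesis .
qed

lemma measurable_det [measurable]:
  fixes f :: "'a \<Rightarrow> real^'n^'n"
  assumes "\<And>i j. (\<lambda>x. f x $ i $ j) \<in> borel_measurable M"
  shows "(\<lambda>x. det (f x)) \<in> borel_measurable M"
  unfolding det_def using assms by (intro borel_measurable_sum borel_measurable_times borel_measurable_prod) auto

lemma measurable_matrixI:
  fixes f :: "'a \<Rightarrow> real^'n^'m"
  assumes "\<And>i j. (\<lambda>x. f x $ i $ j) \<in> borel_measurable M"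
  shows "f \<in> borel_measurable M"
proof (subst borel_measurable_euclidean_space, intro ballI)
  fix b :: "real^'n^'m" assume "b \<in> Basis"
  then obtain i u where b: "b = axis i u" "u \<in> Basis" unfolding Basis_vec_def by blast
  then obtain j where "u = axis j 1" unfolding Basis_vec_def by auto
  then show "(\<lambda>x. f x \<bullet> b) \<in> borel_measurable M" using b assms by (simp add: inner_axis)
qed

lemma measurable_entry [measurable]: "(\<lambda>A :: real^'n^'m. A $ i $ j) \<in> borel_measurable borel"
  by (intro borel_measurable_continuous_onI continuous_intros)

text \<open>Cramer's rule applied to a column of the identity; it exhibits the entries of the
  inverse as quotients of determinants, hence as measurable functions.\<close>

lemma matrix_inv_entry:
  fixes A :: "real^'n^'n"
  assumes "det A \<noteq> 0"
  shows "matrix_inv A $ k $ l = det (\<chi> i j. if j = k then axis l 1 $ i else A $ i $ j) / det A"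
proof -
  obtain B where B: "A ** B = mat 1"
    using assms by (metis invertible_det_nz invertible_def)
  have "A *v (B *v axis l 1) = axis l 1" using B by (simp add: matrix_vector_mul_assoc)
  then have "B *v axis l 1 = (\<chi> k. det (\<chi> i j. if j = k then axis l 1 $ i else A $ i $ j) / det A)"
    by (rule cramer[OF assms, THEN iffD1])
  then have "(B *v axis l 1) $ k = det (\<chi> i j. if j = k then axis l 1 $ i else A $ i $ j) / det A" by simp
  then show ?thesis
    using matrix_inv_unique[OF B] by (simp add: matrix_vector_mult_basis column_def)
qed

lemma measurable_matrix_inv:
  "(matrix_inv :: real^'n^'n \<Rightarrow> real^'n^'n) \<in> borel_measurable (restrict_space borel {A. posdef A})"
proof (rule measurable_matrixI)
  fix k l :: 'n
  let ?f = "\<lambda>A :: real^'n^'n. det (\<chi> i j. if j = k then axis l 1 $ i else A $ i $ j) / det A"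
  have "(\<lambda>A :: real^'n^'n. (if j = k then axis l 1 $ i else A $ i $ j) :: real) \<in> borel_measurable borel" for i j
    by (cases "j = k") auto
  then have "?f \<in> borel_measurable borel" by (intro borel_measurable_divide measurable_det) auto
  then have "?f \<in> borel_measurable (restrict_space borel {A. posdef A})"
    by (rule measurable_restrict_space1)
  then show "(\<lambda>A :: real^'n^'n. matrix_inv A $ k $ l) \<in> borel_measurable (restrict_space borel {A. posdef A})"
    by (rule measurable_cong[THEN iffD1, rotated])
      (use posdef_det_pos in \<open>force simp: space_restrict_space matrix_inv_entry\<close>)
qed

subsection \<open>Integrability on the positive definite cone\<close>

lemma nn_integral_exp_neg_abs_finite:
  fixes c :: real
  assumes c: "c > 0"
  shows "(\<integral>\<^sup>+ x. ennreal (exp (- c * \<bar>x\<bar>)) \<partial>lborel) < \<infinity>"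
proof -
  define g where "g = (\<lambda>x::real. ennreal (exp (- c * x)) * indicator {0..} x)"
  have [measurable]: "g \<in> borel_measurable borel" by (simp add: g_def)
  have "integral\<^sup>N lborel g = ennreal (exp (- c * 0) / c)"
    unfolding g_def by (rule nn_integral_has_integral_lebesgue'[OF _ has_integral_exp_minus_to_infinity[OF c]]) simp
  then have fin: "integral\<^sup>N lborel g < \<infinity>" by simp
  have "(\<integral>\<^sup>+ x. ennreal (exp (- c * \<bar>x\<bar>)) \<partial>lborel) \<le> (\<integral>\<^sup>+ x. g x + g (- x) \<partial>lborel)"
    by (intro nn_integral_mono) (auto simp: g_def abs_if indicator_def)
  also have "\<dots> = integral\<^sup>N lborel g + (\<integral>\<^sup>+ x. g (- x) \<partial>lborel)" by (subst nn_integral_add) auto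
  also have "(\<integral>\<^sup>+ x. g (- x) \<partial>lborel) = integral\<^sup>N lborel g"
    using nn_integral_real_affine[of g "-1" 0] by simp
  also have "integral\<^sup>N lborel g + integral\<^sup>N lborel g < \<infinity>" using fin by simp
  finally show ?thesis .
qed

text \<open>Uniform in the offset \<open>r\<close>: this is what makes the off-diagonal entries harmless when the
  diagonal entries are integrated out one at a time.\<close>

lemma nn_integral_powr_affine_bound:
  fixes e c :: real
  assumes e: "-1 < e" "e \<le> 0" and c: "c > 0"
  obtains K :: ennreal where "K < \<infinity>"
    "\<And>m r. m > 0 \<Longrightarrow>
      (\<integral>\<^sup>+ y. ennreal ((if y * m + r > 0 then (y * m + r) powr e else 0) * exp (- c * \<bar>y\<bar>)) \<partial>lborel)
      \<le> ennreal (m powr e) * K"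
proof
  \<comment> \<open>\<open>h\<close> carries the singularity at 0, integrable since
    \<open>e > -1\<close>, and \<open>w\<close> carries the decay at infinity.\<close>
  define h where "h = (\<lambda>u::real. ennreal (u powr e) * indicator {0..1} u)"
  define w where "w = (\<lambda>y::real. ennreal (exp (- c * \<bar>y\<bar>)))"
  have [measurable]: "h \<in> borel_measurable borel" "w \<in> borel_measurable borel" by (simp_all add: h_def w_def)
  have "integral\<^sup>N lborel h = ennreal (1 powr (e + 1) / (e + 1))"
    unfolding h_def by (rule nn_integral_has_integral_lebesgue') (use e has_integral_powr_from_0[of e 1] in auto)
  then have "integral\<^sup>N lborel h < \<infinity>" by simp
  moreover have "integral\<^sup>N lborel w < \<infinity>" unfolding w_def by (rule nn_integral_exp_neg_abs_finite[OF c])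
  ultimately show "integral\<^sup>N lborel h + integral\<^sup>N lborel w < \<infinity>" by simp
  fix m r :: real assume m: "m > 0"
  \<comment> \<open>Factoring out \<open>m\<close> leaves a pure shift by \<open>q\<close>, which
    translation invariance of \<open>lborel\<close> removes; the resulting constant depends on
    neither \<open>m\<close> nor \<open>r\<close>.\<close>
  define q where "q = r / m"
  have "(\<integral>\<^sup>+ y. ennreal ((if y * m + r > 0 then (y * m + r) powr e else 0) * exp (- c * \<bar>y\<bar>)) \<partial>lborel)
    \<le> (\<integral>\<^sup>+ y. ennreal (m powr e) * (h (q + 1 * y) + w y) \<partial>lborel)"
  proof (intro nn_integral_mono)
    fix y :: real
    have eq: "y * m + r = m * (q + y)" using m by (simp add: q_def field_simps)
    show "ennreal ((if y * m + r > 0 then (y * m + r) powr e else 0) * exp (- c * \<bar>y\<bar>))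
      \<le> ennreal (m powr e) * (h (q + 1 * y) + w y)"
    proof (cases "q + y > 0")
      case True
      then have pow: "(y * m + r) powr e = m powr e * (q + y) powr e"
        unfolding eq using m by (simp add: powr_mult)
      have pos: "y * m + r > 0" using True m by (simp add: eq)
      have "ennreal ((q + y) powr e * exp (- c * \<bar>y\<bar>)) \<le> h (q + y) + w y"
      \<comment> \<open>Up to 1 the exponential is bounded by 1; beyond 1 the power is bounded by 1
        because \<open>e \<le> 0\<close>.\<close>
      proof (cases "q + y \<le> 1")
        case le: True
        have "(q + y) powr e * exp (- c * \<bar>y\<bar>) \<le> (q + y) powr e * 1"
          using c by (intro mult_left_mono) auto
        then have "ennreal ((q + y) powr e * exp (- c * \<bar>y\<bar>)) \<le> h (q + y)"
          unfolding h_def using le True by (simp add: ennreal_leI)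
        then show ?thesis by (metis add_increasing2 zero_le)
      next
        case False
        then have "(q + y) powr e \<le> 1" using e powr_mono[of e 0 "q + y"] by simp
        then have "(q + y) powr e * exp (- c * \<bar>y\<bar>) \<le> 1 * exp (- c * \<bar>y\<bar>)"
          by (intro mult_right_mono) auto
        then have "ennreal ((q + y) powr e * exp (- c * \<bar>y\<bar>)) \<le> w y"
          unfolding w_def by (simp add: ennreal_leI)
        then show ?thesis by (metis add_increasing zero_le)
      qed
      then have "ennreal (m powr e) * ennreal ((q + y) powr e * exp (- c * \<bar>y\<bar>))
        \<le> ennreal (m powr e) * (h (q + y) + w y)" by (rule mult_left_mono) simp
      then show ?thesis using pos by (simp add: pow ennreal_mult'[symmetric] mult.assoc)
    next
      case False
      then have "\<not> y * m + r > 0" using m by (simp add: eq zero_less_mult_iff)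
      then show ?thesis by simp
    qed
  qed
  also have "\<dots> = ennreal (m powr e) * ((\<integral>\<^sup>+ y. h (q + 1 * y) \<partial>lborel) + integral\<^sup>N lborel w)"
    by (subst nn_integral_cmult, measurable, subst nn_integral_add) auto
  also have "(\<integral>\<^sup>+ y. h (q + 1 * y) \<partial>lborel) = integral\<^sup>N lborel h"
    using nn_integral_real_affine[of h 1 q] by simp
  finally show "(\<integral>\<^sup>+ y. ennreal ((if y * m + r > 0 then (y * m + r) powr e else 0) * exp (- c * \<bar>y\<bar>)) \<partial>lborel)
    \<le> ennreal (m powr e) * (integral\<^sup>N lborel h + integral\<^sup>N lborel w)" .
qed

text \<open>The principal minor on \<open>K\<close> of the symmetric matrix with entries \<open>f {i, j}\<close>. Padding with the identity
  outside \<open>K\<close> keeps the matrix type fixed, which allows induction on \<open>K\<close>.\<close>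

definition pminor :: "'n::finite set \<Rightarrow> ('n set \<Rightarrow> real) \<Rightarrow> real" where
  "pminor K f =
    det ((\<chi> i j. if i \<in> K \<and> j \<in> K then f {i, j} else if i = j then 1 else 0) :: real^'n^'n)"

text \<open>In the Leibniz sum a permutation moving \<open>k\<close> picks a zero from row
  \<open>k\<close>, and one fixing \<open>k\<close> never looks at the rest of column
  \<open>k\<close>.\<close>

lemma det_unit_row:
  fixes A B :: "'a::comm_ring_1^'n^'n"
  assumes A: "A $ k = axis k 1" and B: "B $ k = axis k 1"
    and eq: "\<And>i j. i \<noteq> k \<Longrightarrow> j \<noteq> k \<Longrightarrow> A $ i $ j = B $ i $ j"
  shows "det A = det B"
  unfolding det_def
proof (rule sum.cong[OF refl])
  fix p assume "p \<in> {p. p permutes (UNIV :: 'n set)}"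
  then have p: "p permutes UNIV" by simp
  have "(\<Prod>i\<in>UNIV. A $ i $ p i) = (\<Prod>i\<in>UNIV. B $ i $ p i)"
  proof (cases "p k = k")
    case True
    then have "p i \<noteq> k" if "i \<noteq> k" for i
      using permutes_inj[OF p] that by (metis injD)
    then have "A $ i $ p i = B $ i $ p i" for i using eq A B by (cases "i = k") auto
    then show ?thesis by simp
  next
    case False
    then have "A $ k $ p k = 0" "B $ k $ p k = 0" using A B by (auto simp: axis_def)
    then have "(\<Prod>i\<in>UNIV. A $ i $ p i) = 0" "(\<Prod>i\<in>UNIV. B $ i $ p i) = 0"
      by (auto intro!: prod_zero)
    then show ?thesis by simp
  qed
  then show "of_int (sign p) * (\<Prod>i\<in>UNIV. A $ i $ p i) = of_int (sign p) * (\<Prod>i\<in>UNIV. B $ i $ p i)" by simp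
qed

text \<open>The coordinate \<open>{k}\<close> is read only at the diagonal position of
  \<open>k\<close>, since \<open>{i, j} = {k}\<close> forces \<open>i = j = k\<close>.\<close>

lemma pminor_update_outside:
  assumes "k \<notin> L"
  shows "pminor L (f({k} := y)) = pminor L f"
proof -
  have "{i, j} \<noteq> {k}" if "i \<in> L" for i j using assms that by auto
  then show ?thesis unfolding pminor_def by (intro arg_cong[where f = det]) (auto simp: vec_eq_iff)
qed

text \<open>Linearity of the determinant in row \<open>k\<close>. The coefficient of
  \<open>y\<close> is a determinant whose row \<open>k\<close> is a unit vector, so the remaining
  entries of column \<open>k\<close> do not matter and it equals the padded minor on
  \<open>K\<close>.\<close>

lemma pminor_insert_affine:
  fixes K :: "'n::finite set"
  assumes k: "k \<notin> K"
  shows "pminor (insert k K) (f({k} := y)) = y * pminor K f + pminor (insert k K) (f({k} := 0))"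
proof -
  let ?M = "\<lambda>y. (\<chi> i j. if i \<in> insert k K \<and> j \<in> insert k K then (f({k} := y)) {i, j}
    else if i = j then 1 else 0) :: real^'n^'n"
  have "?M y = (\<chi> i. if i = k then y *s axis k 1 + ?M 0 $ k else ?M 0 $ i)"
    by (auto simp: vec_eq_iff axis_def)
  then have "det (?M y) = y * det (\<chi> i. if i = k then axis k 1 else ?M 0 $ i)
      + det (\<chi> i. if i = k then ?M 0 $ k else ?M 0 $ i)"
    by (simp only: det_row_add det_row_mul)
  also have "(\<chi> i. if i = k then ?M 0 $ k else ?M 0 $ i) = ?M 0" by (simp add: vec_eq_iff)
  also have "det (\<chi> i. if i = k then axis k 1 else ?M 0 $ i) = pminor K f"
    unfolding pminor_def
    by (rule det_unit_row[of _ k]) (use k in \<open>auto simp: vec_eq_iff axis_def\<close>)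
  finally show ?thesis unfolding pminor_def .
qed

text \<open>The padded matrix is itself positive definite: its form is that of the original matrix
  at the restriction of \<open>x\<close> to \<open>L\<close>, plus the squares of the coordinates
  outside \<open>L\<close>.\<close>

lemma pminor_posdef:
  fixes f :: "'n::finite set \<Rightarrow> real"
  assumes S: "posdef (\<chi> i j. f {i, j})"
  shows "pminor L f > 0"
proof -
  let ?S = "(\<chi> i j. f {i, j}) :: real^'n^'n"
  let ?M = "(\<chi> i j. if i \<in> L \<and> j \<in> L then f {i, j} else if i = j then 1 else 0) :: real^'n^'n"
  have "x \<bullet> (?M *v x) > 0" if x: "x \<noteq> 0" for x
  proof -
    define y where "y = (\<chi> i. if i \<in> L then x $ i else 0)"
    have "x \<bullet> (?M *v x) = (\<Sum>i\<in>UNIV. \<Sum>j\<in>UNIV. y $ i * ?S $ i $ j * y $ j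
        + (if j = i then (if i \<in> L then 0 else (x $ i)\<^sup>2) else 0))"
      unfolding quadratic_form_sum y_def by (intro sum.cong) (auto simp: power2_eq_square)
    also have "\<dots> = y \<bullet> (?S *v y) + (\<Sum>i\<in>UNIV. if i \<in> L then 0 else (x $ i)\<^sup>2)"
      unfolding quadratic_form_sum by (simp add: sum.distrib)
    also have "\<dots> > 0"
    proof (cases "y = 0")
      case True
      obtain i where i: "x $ i \<noteq> 0" using x by (auto simp: vec_eq_iff)
      moreover have "y $ i = 0" using True by simp
      ultimately have "i \<notin> L" by (auto simp: y_def)
      then have "(\<Sum>i\<in>UNIV. if i \<in> L then 0 else (x $ i)\<^sup>2) > 0"
        using i by (intro sum_pos2[of _ i]) auto
      then show ?thesis using True by simp
    next
      case False
      then have "y \<bullet> (?S *v y) > 0" using S by (auto simp: posdef_def)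
      then show ?thesis by (intro add_pos_nonneg sum_nonneg) auto
    qed
    finally show ?thesis .
  qed
  moreover have "transpose ?M = ?M"
    by (auto simp: vec_eq_iff transpose_def insert_commute)
  ultimately have "posdef ?M" by (simp add: posdef_def)
  then show ?thesis unfolding pminor_def by (rule posdef_det_pos)
qed

text \<open>All off-diagonal coordinates are present from the start and only the diagonal ones
  depend on \<open>K\<close>, because the induction integrates out diagonal entries alone.\<close>

definition entry_index :: "'n::finite set \<Rightarrow> 'n set set" where
  "entry_index K = {{i, j} | i j. i \<noteq> j} \<union> (\<lambda>i. {i}) ` K"

lemma entry_index_UNIV: "entry_index UNIV = {{i, j} | i j. True}"
  unfolding entry_index_def by auto

lemma entry_index_insert: "entry_index (insert k K) = insert {k} (entry_index K)"
  by (auto simp: entry_index_def)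

lemma singleton_in_entry_index: "{k} \<in> entry_index K \<longleftrightarrow> k \<in> K"
  by (auto simp: entry_index_def)

lemma measurable_pminor:
  fixes L K :: "'n::finite set"
  assumes "L \<subseteq> K"
  shows "pminor L \<in> borel_measurable (\<Pi>\<^sub>M p\<in>entry_index K. (lborel :: real measure))"
  unfolding pminor_def
proof (rule measurable_det)
  fix i j
  have "{i, j} \<in> entry_index K" if "i \<in> L" "j \<in> L"
    using assms that by (cases "i = j") (auto simp: entry_index_def)
  then show "(\<lambda>f. (\<chi> i j. if i \<in> L \<and> j \<in> L then f {i, j} else if i = j then 1 else 0) $ i $ j)
    \<in> borel_measurable (\<Pi>\<^sub>M p\<in>entry_index K. (lborel :: real measure))"
    by (cases "i \<in> L \<and> j \<in> L") auto
qed

text \<open>Induction on \<open>K\<close>, one diagonal entry at a time. The minor on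
  \<open>insert k K\<close> is affine in the new entry with slope \<open>pminor K f\<close>, so
  \<open>nn_integral_powr_affine_bound\<close> returns the integrand for \<open>K\<close> times a
  constant. Positivity of all principal minors replaces positive definiteness because it restricts
  to subsets and keeps the slope positive.\<close>

lemma nn_integral_pminor_powr_finite:
  fixes e c :: real and K :: "'n::finite set"
  assumes e: "-1 < e" "e \<le> 0" and c: "c > 0"
  shows "(\<integral>\<^sup>+ f. ennreal ((if \<forall>L\<subseteq>K. pminor L f > 0 then pminor K f powr e else 0) *
      (\<Prod>p\<in>entry_index K. exp (- c * \<bar>f p\<bar>))) \<partial>(\<Pi>\<^sub>M p\<in>entry_index K. (lborel :: real measure))) < \<infinity>"
proof -
  interpret P: product_sigma_finite "\<lambda>p :: 'n set. (lborel :: real measure)"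
    by standard
  define G where "G = (\<lambda>(K :: 'n set) f. (if \<forall>L\<subseteq>K. pminor L f > 0 then pminor K f powr e else 0) *
      (\<Prod>p\<in>entry_index K. exp (- c * \<bar>f p\<bar>)))"
  let ?M = "\<lambda>K :: 'n set. \<Pi>\<^sub>M p\<in>entry_index K. (lborel :: real measure)"
  obtain C where C: "C < \<infinity>" "\<And>m r. m > 0 \<Longrightarrow>
      (\<integral>\<^sup>+ y. ennreal ((if y * m + r > 0 then (y * m + r) powr e else 0) * exp (- c * \<bar>y\<bar>)) \<partial>lborel)
      \<le> ennreal (m powr e) * C" using nn_integral_powr_affine_bound[OF e c] by blast
  have mG [measurable]: "G K \<in> borel_measurable (?M K)" for K
  proof -
    have [measurable]: "pminor L \<in> borel_measurable (?M K)" if "L \<subseteq> K" for L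
      using that by (rule measurable_pminor)
    have "Measurable.pred (?M K) (\<lambda>f. \<forall>L\<in>Pow K. pminor L f > 0)"
      by (rule pred_intros_finite) auto
    then have [measurable]: "Measurable.pred (?M K) (\<lambda>f. \<forall>L\<subseteq>K. pminor L f > 0)" by (simp add: Pow_def)
    show ?thesis unfolding G_def by measurable
  qed
  have "(\<integral>\<^sup>+ f. ennreal (G K f) \<partial>?M K) < \<infinity>" for K
  proof (induction K rule: finite_induct[OF finite])
    case 1
    \<comment> \<open>The empty minor is the determinant of the identity, so only the product of
      exponentials over the off-diagonal entries remains.\<close>
    have "(\<integral>\<^sup>+ f. ennreal (G {} f) \<partial>?M {}) \<le> (\<integral>\<^sup>+ f. (\<Prod>p\<in>entry_index ({} :: 'n set). ennreal (exp (- c * \<bar>f p\<bar>))) \<partial>?M {})"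
      unfolding G_def by (intro nn_integral_mono) (auto simp: prod_ennreal pminor_def mat_def[symmetric] prod_nonneg)
    also have "\<dots> = (\<Prod>p\<in>entry_index ({} :: 'n set). \<integral>\<^sup>+ y. ennreal (exp (- c * \<bar>y\<bar>)) \<partial>lborel)"
      by (subst P.product_nn_integral_prod) auto
    also have "\<dots> < \<infinity>" 
      using nn_integral_exp_neg_abs_finite[OF c] by (simp add: power_less_top_ennreal)
    finally show ?case .
  next
    case (2 k K)
    have "(\<integral>\<^sup>+ f. ennreal (G (insert k K) f) \<partial>?M (insert k K))
      = (\<integral>\<^sup>+ f. (\<integral>\<^sup>+ y. ennreal (G (insert k K) (f({k} := y))) \<partial>lborel) \<partial>?M K)"
      unfolding entry_index_insert
      using mG[of "insert k K"] 2(2)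
      by (subst P.product_nn_integral_insert) (auto simp: singleton_in_entry_index entry_index_insert)
    also have "\<dots> \<le> (\<integral>\<^sup>+ f. ennreal (G K f) * C \<partial>?M K)"
    proof (intro nn_integral_mono)
      fix f :: "'n set \<Rightarrow> real"
      show "(\<integral>\<^sup>+ y. ennreal (G (insert k K) (f({k} := y))) \<partial>lborel) \<le> ennreal (G K f) * C"
      proof (cases "\<forall>L\<subseteq>K. pminor L f > 0")
        \<comment> \<open>A minor inside \<open>K\<close> does not see the entry \<open>{k}\<close>,
          so if it fails to be positive, the integrand vanishes for every \<open>y\<close>.\<close>
        case False
        then obtain L where L: "L \<subseteq> K" "\<not> pminor L f > 0" by auto
        then have "\<not> pminor L (f({k} := y)) > 0" for y
          using 2(2) by (subst pminor_update_outside) auto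
        then have "G (insert k K) (f({k} := y)) = 0" for y
          using L(1) unfolding G_def by (auto simp del: fun_upd_apply)
        then show ?thesis by simp
      next
        case True
        define m where "m = pminor K f"
        define r where "r = pminor (insert k K) (f({k} := 0))"
        define W where "W = (\<Prod>p\<in>entry_index K. exp (- c * \<bar>f p\<bar>))"
        have m: "m > 0" using True by (simp add: m_def)
        have W: "W \<ge> 0" unfolding W_def by (intro prod_nonneg) auto
        have pw: "(\<Prod>p\<in>entry_index (insert k K). exp (- c * \<bar>(f({k} := y)) p\<bar>)) = exp (- c * \<bar>y\<bar>) * W" for y
        proof -
          have "(\<Prod>p\<in>entry_index K. exp (- c * \<bar>(f({k} := y)) p\<bar>)) = W"
            unfolding W_def using 2(2) by (intro prod.cong) (auto simp: singleton_in_entry_index)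
          then show ?thesis
            unfolding entry_index_insert using 2(2)
            by (subst prod.insert) (auto simp: singleton_in_entry_index)
        qed
        have "ennreal (G (insert k K) (f({k} := y))) \<le> ennreal W *
          ennreal ((if y * m + r > 0 then (y * m + r) powr e else 0) * exp (- c * \<bar>y\<bar>))" for y
        proof -
          have pm: "pminor (insert k K) (f({k} := y)) = y * m + r"
            unfolding m_def r_def by (rule pminor_insert_affine[OF 2(2)])
          \<comment> \<open>Only the positivity of the largest minor is retained; dropping the other
            conditions enlarges the integrand.\<close>
          have "G (insert k K) (f({k} := y)) \<le>
            (if y * m + r > 0 then (y * m + r) powr e else 0) * (exp (- c * \<bar>y\<bar>) * W)"
            unfolding G_def pw using W pm
            by (intro mult_right_mono) (auto simp del: fun_upd_apply)
          then show ?thesis using W by (simp add: ennreal_mult'[symmetric] ennreal_leI mult_ac)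
        qed
        then have "(\<integral>\<^sup>+ y. ennreal (G (insert k K) (f({k} := y))) \<partial>lborel) \<le> (\<integral>\<^sup>+ y. ennreal W *
          ennreal ((if y * m + r > 0 then (y * m + r) powr e else 0) * exp (- c * \<bar>y\<bar>)) \<partial>lborel)"
          by (rule nn_integral_mono)
        also have "\<dots> = ennreal W * (\<integral>\<^sup>+ y.
          ennreal ((if y * m + r > 0 then (y * m + r) powr e else 0) * exp (- c * \<bar>y\<bar>)) \<partial>lborel)"
          by (rule nn_integral_cmult) measurable
        also have "\<dots> \<le> ennreal W * (ennreal (m powr e) * C)"
          by (intro mult_left_mono C(2) m) auto
        also have "\<dots> = ennreal (G K f) * C"
        proof -
          have "G K f = m powr e * W" unfolding G_def W_def m_def using True by simp
          then show ?thesis using W by (simp add: ennreal_mult' mult_ac)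
        qed
        finally show ?thesis .
      qed
    qed
    also have "\<dots> = (\<integral>\<^sup>+ f. ennreal (G K f) \<partial>?M K) * C"
      by (rule nn_integral_multc) measurable
    also have "\<dots> < \<infinity>" using 2(3) C(1) by (simp add: ennreal_mult_less_top)
    finally show ?case .
  qed
  then show ?thesis unfolding G_def .
qed

section \<open>From coordinates to integrals over symmetric matrices\<close>

lemma measurable_sym_embed [measurable]:
  "(\<lambda>f. (\<chi> i j. f {i, j}) :: real^'n^'n) \<in>
    borel_measurable (\<Pi>\<^sub>M p\<in>{{i, j} | i j :: 'n. True}. (lborel :: real measure))"
proof (rule measurable_matrixI)
  fix i j :: 'n
  have "{i, j} \<in> {{i, j} | i j :: 'n. True}" by auto
  then show "(\<lambda>f. (\<chi> i j. f {i, j}) $ i $ j) \<in> borel_measurable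
      (\<Pi>\<^sub>M p\<in>{{i, j} | i j :: 'n. True}. (lborel :: real measure))"
    by simp
qed

lemma sets_sym_lborel [measurable_cong]: "sets sym_lborel = sets borel"
  by (simp add: sym_lborel_def)

lemma nn_integral_sym_lborel:
  fixes h :: "real^'n^'n \<Rightarrow> ennreal"
  assumes [measurable]: "h \<in> borel_measurable borel"
  shows "integral\<^sup>N sym_lborel h =
    (\<integral>\<^sup>+ f. h (\<chi> i j. f {i, j}) \<partial>(\<Pi>\<^sub>M p\<in>{{i, j} | i j :: 'n. True}. (lborel :: real measure)))"
  unfolding sym_lborel_def by (rule nn_integral_distr) measurable

lemma measurable_trace_mult [measurable]: "(\<lambda>S :: real^'n^'n. trace (P ** S)) \<in> borel_measurable borel"
  unfolding trace_def matrix_matrix_mult_def by simp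

lemma measurable_trace [measurable]: "(\<lambda>S :: real^'n^'n. trace S) \<in> borel_measurable borel"
  unfolding trace_def by simp

lemma measurable_det_borel [measurable]: "(det :: real^'n^'n \<Rightarrow> real) \<in> borel_measurable borel"
  using measurable_det[of "\<lambda>x. x" borel] by simp

text \<open>For \<open>p > 0\<close>, raise \<open>z \<le> exp z\<close> at
  \<open>z = u * c / p\<close> to the power \<open>p\<close> and rescale.\<close>

lemma powr_le_exp:
  fixes p c :: real
  assumes p: "p \<ge> 0" and c: "c > 0"
  obtains K where "K > 0" "\<And>u. u > 0 \<Longrightarrow> u powr p \<le> K * exp (c * u)"
proof (cases "p = 0")
  case True
  show thesis by (rule that[of 1]) (use c True in auto)
next
  case False
  with p have p: "p > 0" by simp
  show thesis
  proof (rule that[of "(p / c) powr p"])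
    show "(p / c) powr p > 0" using p c by simp
    fix u :: real assume u: "u > 0"
    have "u * c / p \<le> exp (u * c / p)" using exp_ge_add_one_self[of "u * c / p"] by linarith
    then have "(u * c / p) powr p \<le> exp (u * c / p) powr p"
      using u c p by (intro powr_mono2) auto
    also have "\<dots> = exp (c * u)" using p by (simp add: powr_def mult_ac)
    finally have "(p / c) powr p * (u * c / p) powr p \<le> (p / c) powr p * exp (c * u)"
      by (intro mult_left_mono) auto
    moreover have "(p / c) powr p * (u * c / p) powr p = u powr p"
      using u c p by (simp add: powr_mult[symmetric])
    ultimately show "u powr p \<le> (p / c) powr p * exp (c * u)" by simp
  qed
qed

lemma nn_integral_posdef_finite_nonpos:
  fixes e c :: real
  assumes e: "-1 < e" "e \<le> 0" and c: "c > 0"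
  shows "(\<integral>\<^sup>+ S. ennreal (indicator {S. posdef S} S * (det S powr e * exp (- c * trace S)))
    \<partial>(sym_lborel :: (real^'n^'n) measure)) < \<infinity>"
proof -
  let ?I = "entry_index (UNIV :: 'n set)"
  let ?h = "\<lambda>S :: real^'n^'n. ennreal (indicator {S. posdef S} S * (det S powr e * exp (- c * trace S)))"
  \<comment> \<open>The decay rate is shared equally among the coordinates: each is at most the
    trace, so \<open>a\<close> times the sum of their absolute values is at most \<open>c\<close>
    times the trace.\<close>
  define a where "a = c / real (card ?I)"
  have "?I \<noteq> {}" by (auto simp: entry_index_def)
  then have cI: "real (card ?I) > 0" by (simp add: card_gt_0_iff)
  then have a: "a > 0" using c by (simp add: a_def)
  have "integral\<^sup>N sym_lborel ?h = (\<integral>\<^sup>+ f. ?h (\<chi> i j. f {i, j}) \<partial>(\<Pi>\<^sub>M p\<in>?I. (lborel :: real measure)))"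
    unfolding entry_index_UNIV by (rule nn_integral_sym_lborel) measurable
  also have "\<dots> \<le> (\<integral>\<^sup>+ f. ennreal ((if \<forall>L\<subseteq>UNIV. pminor L f > 0 then pminor UNIV f powr e else 0) *
      (\<Prod>p\<in>?I. exp (- a * \<bar>f p\<bar>))) \<partial>(\<Pi>\<^sub>M p\<in>?I. (lborel :: real measure)))"
  proof (intro nn_integral_mono ennreal_leI)
    fix f :: "'n set \<Rightarrow> real"
    let ?S = "(\<chi> i j. f {i, j}) :: real^'n^'n"
    show "indicator {S. posdef S} ?S * (det ?S powr e * exp (- c * trace ?S))
      \<le> (if \<forall>L\<subseteq>UNIV. pminor L f > 0 then pminor UNIV f powr e else 0) * (\<Prod>p\<in>?I. exp (- a * \<bar>f p\<bar>))"
    proof (cases "posdef ?S")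
      case True
      have "\<bar>f p\<bar> \<le> trace ?S" if p: "p \<in> ?I" for p
      proof -
        obtain i j where "p = {i, j}" using p unfolding entry_index_UNIV by auto
        then show ?thesis using posdef_abs_entry_le_trace[OF True, of i j] by simp
      qed
      then have "(\<Sum>p\<in>?I. \<bar>f p\<bar>) \<le> real (card ?I) * trace ?S"
        by (intro sum_bounded_above) auto
      then have "a * (\<Sum>p\<in>?I. \<bar>f p\<bar>) \<le> a * (real (card ?I) * trace ?S)"
        using a by (intro mult_left_mono) auto
      also have "\<dots> = c * trace ?S" unfolding a_def using \<open>?I \<noteq> {}\<close> by simp
      finally have "exp (- c * trace ?S) \<le> exp (- a * (\<Sum>p\<in>?I. \<bar>f p\<bar>))" by simp
      also have "\<dots> = (\<Prod>p\<in>?I. exp (- a * \<bar>f p\<bar>))" by (simp add: exp_sum sum_distrib_left)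
      finally have "det ?S powr e * exp (- c * trace ?S) \<le> det ?S powr e * (\<Prod>p\<in>?I. exp (- a * \<bar>f p\<bar>))"
        by (intro mult_left_mono) auto
      moreover have "pminor UNIV f = det ?S" by (simp add: pminor_def)
      moreover have "\<forall>L\<subseteq>UNIV. pminor L f > 0" using pminor_posdef[OF True] by simp
      ultimately show ?thesis using True by simp
    next
      case False
      then show ?thesis by (simp add: prod_nonneg)
    qed
  qed
  also have "\<dots> < \<infinity>" by (rule nn_integral_pminor_powr_finite[OF e a])
  finally show ?thesis .
qed

text \<open>For positive \<open>e\<close> the determinant is at most a power of the trace, which
  half of the exponential absorbs; what remains is the case of exponent 0.\<close>

lemma nn_integral_posdef_finite:
  fixes e c :: real
  assumes e: "-1 < e" and c: "c > 0"
  shows "(\<integral>\<^sup>+ S. ennreal (indicator {S. posdef S} S * (det S powr e * exp (- c * trace S)))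
    \<partial>(sym_lborel :: (real^'n^'n) measure)) < \<infinity>"
proof (cases "e \<le> 0")
  case False
  then have e: "e > 0" by simp
  obtain K where K: "K > 0" "\<And>u. u > 0 \<Longrightarrow> u powr (real CARD('n) * e) \<le> K * exp (c / 2 * u)"
    using powr_le_exp[of "real CARD('n) * e" "c / 2"] e c by auto
  have "(\<integral>\<^sup>+ S. ennreal (indicator {S. posdef S} S * (det S powr e * exp (- c * trace S)))
    \<partial>(sym_lborel :: (real^'n^'n) measure)) \<le> (\<integral>\<^sup>+ S. ennreal K *
      ennreal (indicator {S. posdef S} S * (det S powr 0 * exp (- (c / 2) * trace S)))
    \<partial>(sym_lborel :: (real^'n^'n) measure))"
  proof (intro nn_integral_mono)
    fix S :: "real^'n^'n"
    show "ennreal (indicator {S. posdef S} S * (det S powr e * exp (- c * trace S))) \<le> ennreal K *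
      ennreal (indicator {S. posdef S} S * (det S powr 0 * exp (- (c / 2) * trace S)))"
    proof (cases "posdef S")
      case True
      note pos = posdef_det_pos[OF True] posdef_trace_pos[OF True]
      have "det S powr e \<le> (trace S ^ CARD('n)) powr e"
        using posdef_det_le_trace_power[OF True] pos e by (intro powr_mono2) auto
      also have "\<dots> = trace S powr (real CARD('n) * e)"
        using pos by (simp add: powr_powr flip: powr_realpow)
      also have "\<dots> \<le> K * exp (c / 2 * trace S)" by (rule K(2)[OF pos(2)])
      finally have "det S powr e * exp (- c * trace S) \<le> (K * exp (c / 2 * trace S)) * exp (- c * trace S)"
        by (intro mult_right_mono) auto
      also have "\<dots> = K * exp (- (c / 2) * trace S)" by (simp add: mult.assoc exp_add[symmetric])
      finally show ?thesis using True pos K(1) by (simp add: ennreal_mult'[symmetric] ennreal_leI)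
    qed simp
  qed
  also have "\<dots> = ennreal K * (\<integral>\<^sup>+ S. 
      ennreal (indicator {S. posdef S} S * (det S powr 0 * exp (- (c / 2) * trace S)))
    \<partial>(sym_lborel :: (real^'n^'n) measure))"
    by (rule nn_integral_cmult) measurable
  also have "\<dots> < \<infinity>"
    using nn_integral_posdef_finite_nonpos[where 'n = 'n, of 0 "c / 2"] c by (simp add: ennreal_mult_less_top)
  finally show ?thesis .
qed (use nn_integral_posdef_finite_nonpos e c in blast)

subsection \<open>Inverse-Wishart probabilities\<close>

text \<open>The smallest Gamma argument, at \<open>j = CARD('n)\<close>, is
  \<open>(\<nu> - CARD('n) + 1) / 2\<close>, positive exactly by the bound on
  \<open>\<nu>\<close>.\<close>

lemma wishart_normalizer_pos:
  fixes V :: "real^'n^'n"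
  assumes "posdef V" "\<nu> > real CARD('n) - 1"
  shows "2 powr (\<nu> * real CARD('n) / 2) * det V powr (\<nu> / 2) * mv_Gamma CARD('n) (\<nu> / 2) > 0"
proof -
  have "Gamma (\<nu> / 2 + (1 - real j) / 2) > 0" if "j \<in> {1..CARD('n)}" for j
    using that assms(2) by (intro Gamma_real_pos) (auto simp: field_simps)
  then have "mv_Gamma CARD('n) (\<nu> / 2) > 0"
    unfolding mv_Gamma_def by (intro mult_pos_pos prod_pos) auto
  then show ?thesis using posdef_det_pos[OF assms(1)] by simp
qed

lemma wishart_density_form:
  fixes \<Psi> :: "real^'n^'n"
  assumes Psi: "posdef \<Psi>" and nu: "\<nu> > real CARD('n) - 1"
  obtains Z where "Z > 0" "\<And>S. wishart_density \<nu> (matrix_inv \<Psi>) S =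
    det S powr ((\<nu> - real CARD('n) - 1) / 2) * exp (- trace (\<Psi> ** S) / 2) / Z"
  using wishart_normalizer_pos[OF posdef_matrix_inv(2)[OF Psi] nu]
  by (rule that) (simp add: wishart_density_def Let_def posdef_matrix_inv(3)[OF Psi])

lemma measurable_wishart_density [measurable]:
  "(wishart_density \<nu> V :: real^'n^'n \<Rightarrow> real) \<in> borel_measurable borel"
  unfolding wishart_density_def Let_def by measurable

text \<open>Inversion is an involution on the cone, so an event about
  \<open>matrix_inv \<Sigma>\<close> pulls back to the same event about the Wishart variable
  \<open>S\<close>.\<close>

lemma emeasure_inv_wishart:
  fixes \<Psi> :: "real^'n^'n"
  assumes Psi: "posdef \<Psi>" and nu: "\<nu> > real CARD('n) - 1"
    and Q: "{S. posdef S \<and> Q S} \<in> sets borel"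
  defines "G \<equiv> inv_wishart \<nu> \<Psi>"
  shows "emeasure G {\<Sigma> \<in> space G. Q (matrix_inv \<Sigma>)} =
    (\<integral>\<^sup>+ S. ennreal (indicator {S. posdef S \<and> Q S} S * wishart_density \<nu> (matrix_inv \<Psi>) S) \<partial>sym_lborel)"
proof -
  let ?P = "{S :: real^'n^'n. posdef S}"
  let ?B = "{S. posdef S \<and> Q S}"
  let ?X = "{\<Sigma> \<in> space G. Q (matrix_inv \<Sigma>)}"
  let ?W = "wishart \<nu> (matrix_inv \<Psi>)"
  have spG: "space G = ?P" by (simp add: G_def inv_wishart_def space_restrict_space)
  have P: "?P \<in> sets sym_lborel" by (simp add: sets_sym_lborel borel_posdef)
  have setsW: "sets ?W = sets (restrict_space borel ?P)"
    by (simp add: wishart_def sets_restrict_space sets_sym_lborel)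
  then have spW: "space ?W = ?P" by (metis sets_eq_imp_space_eq space_borel space_restrict_space inf_top_right)
  have m: "matrix_inv \<in> restrict_space borel ?P \<rightarrow>\<^sub>M restrict_space borel ?P"
    using measurable_matrix_inv by (intro measurable_restrict_space2) (auto simp: space_restrict_space posdef_matrix_inv)
  have BR: "?B \<in> sets (restrict_space borel ?P)"
    using Q borel_posdef by (subst sets_restrict_space_iff) auto
  have "?X = matrix_inv -` ?B \<inter> space (restrict_space borel ?P)"
    by (auto simp: spG space_restrict_space posdef_matrix_inv)
  then have X: "?X \<in> sets (restrict_space borel ?P)" using measurable_sets[OF m BR] by simp
  have "emeasure G ?X = emeasure ?W (matrix_inv -` ?X \<inter> space ?W)"
    unfolding G_def inv_wishart_def
    by (rule emeasure_distr)
      (use m X setsW in \<open>simp_all add: G_def inv_wishart_def measurable_cong_sets[OF setsW refl]\<close>)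
  also have "matrix_inv -` ?X \<inter> space ?W = ?B"
    by (auto simp: spG spW posdef_matrix_inv)
  also have "emeasure ?W ?B = (\<integral>\<^sup>+ S. ennreal (wishart_density \<nu> (matrix_inv \<Psi>) S) * indicator ?B S
      \<partial>(restrict_space sym_lborel ?P))"
    unfolding wishart_def
  proof (rule emeasure_density)
    have "wishart_density \<nu> (matrix_inv \<Psi>) \<in> borel_measurable sym_lborel"
      by measurable
    then have "wishart_density \<nu> (matrix_inv \<Psi>) \<in> borel_measurable (restrict_space sym_lborel ?P)"
      by (rule measurable_restrict_space1)
    then show "(\<lambda>S. ennreal (wishart_density \<nu> (matrix_inv \<Psi>) S)) \<in> borel_measurable (restrict_space sym_lborel ?P)"
      by simp
    show "?B \<in> sets (restrict_space sym_lborel ?P)"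
      using BR by (simp add: sets_restrict_space sets_sym_lborel)
  qed
  also have "\<dots> = (\<integral>\<^sup>+ S. ennreal (wishart_density \<nu> (matrix_inv \<Psi>) S) * indicator ?B S * indicator ?P S \<partial>sym_lborel)"
    using P by (subst nn_integral_restrict_space) (auto simp: sets.Int_space_eq2)
  also have "\<dots> = (\<integral>\<^sup>+ S. ennreal (indicator ?B S * wishart_density \<nu> (matrix_inv \<Psi>) S) \<partial>sym_lborel)"
    by (intro nn_integral_cong) (auto simp: indicator_def)
  finally show ?thesis .
qed

text \<open>Turns a pointwise bound on the density over an event into a probability bound. The
  constant \<open>b\<close> is independent of \<open>K\<close> and \<open>Q\<close>, so all
  dependence on the tail parameter sits in \<open>K\<close>.\<close>

lemma inv_wishart_upper_bound:
  fixes \<Psi> :: "real^'n^'n"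
  assumes Psi: "posdef \<Psi>" and nu: "\<nu> > real CARD('n) - 1" and e: "e > -1" and c: "c > 0"
  defines "G \<equiv> inv_wishart \<nu> \<Psi>"
  obtains b where "b > 0"
    "\<And>K Q. K \<ge> 0 \<Longrightarrow> {S. posdef S \<and> Q S} \<in> sets borel \<Longrightarrow>
      (\<And>S. posdef S \<Longrightarrow> Q S \<Longrightarrow>
        wishart_density \<nu> (matrix_inv \<Psi>) S \<le> K * (det S powr e * exp (- c * trace S))) \<Longrightarrow>
      emeasure G {\<Sigma> \<in> space G. Q (matrix_inv \<Sigma>)} \<le> ennreal (b * K)"
proof -
  define J where "J = (\<integral>\<^sup>+ S. ennreal (indicator {S. posdef S} S * (det S powr e * exp (- c * trace S)))
    \<partial>(sym_lborel :: (real^'n^'n) measure))"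
  have J: "J < \<infinity>" unfolding J_def by (rule nn_integral_posdef_finite[OF e c])
  \<comment> \<open>Adding 1 makes the constant strictly positive without a lower bound on
    \<open>J\<close>.\<close>
  show thesis
  proof (rule that[of "enn2real J + 1"])
    show "enn2real J + 1 > 0" by (simp add: add_nonneg_pos)
    fix K :: real and Q :: "real^'n^'n \<Rightarrow> bool"
    assume K: "K \<ge> 0" and Q: "{S. posdef S \<and> Q S} \<in> sets borel"
      and le: "\<And>S. posdef S \<Longrightarrow> Q S \<Longrightarrow>
        wishart_density \<nu> (matrix_inv \<Psi>) S \<le> K * (det S powr e * exp (- c * trace S))"
    have "emeasure G {\<Sigma> \<in> space G. Q (matrix_inv \<Sigma>)} =
      (\<integral>\<^sup>+ S. ennreal (indicator {S. posdef S \<and> Q S} S * wishart_density \<nu> (matrix_inv \<Psi>) S) \<partial>sym_lborel)"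
      unfolding G_def by (rule emeasure_inv_wishart[OF Psi nu Q])
    also have "\<dots> \<le> (\<integral>\<^sup>+ S. ennreal K * ennreal (indicator {S. posdef S} S * (det S powr e * exp (- c * trace S)))
      \<partial>(sym_lborel :: (real^'n^'n) measure))"
    proof (intro nn_integral_mono)
      fix S :: "real^'n^'n"
      show "ennreal (indicator {S. posdef S \<and> Q S} S * wishart_density \<nu> (matrix_inv \<Psi>) S)
        \<le> ennreal K * ennreal (indicator {S. posdef S} S * (det S powr e * exp (- c * trace S)))"
        using le[of S] K by (cases "posdef S \<and> Q S") (auto simp: ennreal_mult'[symmetric] intro!: ennreal_leI)
    qed
    also have "\<dots> = ennreal K * J"
      unfolding J_def by (rule nn_integral_cmult) measurable
    also have "\<dots> = ennreal (K * enn2real J)"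
      using J K by (simp add: ennreal_mult')
    also have "\<dots> \<le> ennreal ((enn2real J + 1) * K)"
      using K by (intro ennreal_leI) (simp add: algebra_simps)
    finally show "emeasure G {\<Sigma> \<in> space G. Q (matrix_inv \<Sigma>)} \<le> ennreal ((enn2real J + 1) * K)" .
  qed
qed

section \<open>Measurability of eigenvalue events and the two tail bounds\<close>

lemma pred_posdef [measurable]: "Measurable.pred borel (posdef :: real^'n^'n \<Rightarrow> bool)"
  using borel_posdef by (simp add: pred_def)

lemma measurable_eig_if_posdef:
  assumes "j \<in> {1..CARD('n)}"
  shows "(\<lambda>S :: real^'n^'n. if posdef S then eig j S else 0) \<in> borel_measurable borel"
proof -
  have [measurable]: "(\<lambda>S :: real^'n^'n. if transpose S = S then eig j S else 0) \<in> borel_measurable borel"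
    by (rule measurable_eig_if_symmetric[OF assms])
  have "(\<lambda>S :: real^'n^'n. if posdef S then (if transpose S = S then eig j S else 0) else 0) \<in> borel_measurable borel"
    by measurable
  also have "(\<lambda>S :: real^'n^'n. if posdef S then (if transpose S = S then eig j S else 0) else 0) =
      (\<lambda>S. if posdef S then eig j S else 0)"
    by (auto simp: posdef_symmetric)
  finally show ?thesis .
qed

lemma borel_posdef_eig:
  assumes j: "j \<in> {1..CARD('n)}" and A: "A \<in> sets borel"
  shows "{S :: real^'n^'n. posdef S \<and> eig j S \<in> A} \<in> sets borel"
proof -
  have [measurable]: "(\<lambda>S :: real^'n^'n. if posdef S then eig j S else 0) \<in> borel_measurable borel"
    by (rule measurable_eig_if_posdef[OF j])
  note A [measurable]
  have "{S :: real^'n^'n. posdef S \<and> eig j S \<in> A} =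
      {S \<in> space borel. posdef S \<and> (if posdef S then eig j S else 0) \<in> A}" by auto
  also have "\<dots> \<in> sets borel" by measurable
  finally show ?thesis .
qed

text \<open>The density decays at rate \<open>c / 2\<close> in the trace. On the event the trace is
  at least \<open>x\<close>, so half of this rate produces the tail factor and the other half keeps
  the integral finite.\<close>

lemma inv_wishart_upper_tail:
  fixes \<Psi> :: "real^'n^'n"
  assumes Psi: "posdef \<Psi>" and nu: "\<nu> > real CARD('n) - 1"
  defines "G \<equiv> inv_wishart \<nu> \<Psi>"
  obtains b C where "b > 0" "C > 0"
    "\<And>x. measure G {\<Sigma> \<in> space G. eig CARD('n) (matrix_inv \<Sigma>) \<ge> x} \<le> b * exp (- C * x)"
proof -
  obtain Z where Z: "Z > 0" "\<And>S. wishart_density \<nu> (matrix_inv \<Psi>) S =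
    det S powr ((\<nu> - real CARD('n) - 1) / 2) * exp (- trace (\<Psi> ** S) / 2) / Z"
    using wishart_density_form[OF Psi nu] by metis
  obtain c where c: "c > 0" "\<And>S. posdef S \<Longrightarrow> c * trace S \<le> trace (\<Psi> ** S)"
    using trace_mult_posdef_lower[OF Psi] by metis
  obtain b where b: "b > 0" 
    "\<And>K Q. K \<ge> 0 \<Longrightarrow> {S. posdef S \<and> Q S} \<in> sets borel \<Longrightarrow>
      (\<And>S. posdef S \<Longrightarrow> Q S \<Longrightarrow> wishart_density \<nu> (matrix_inv \<Psi>) S
        \<le> K * (det S powr ((\<nu> - real CARD('n) - 1) / 2) * exp (- (c / 4) * trace S))) \<Longrightarrow>
      emeasure G {\<Sigma> \<in> space G. Q (matrix_inv \<Sigma>)} \<le> ennreal (b * K)"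
    unfolding G_def
    using inv_wishart_upper_bound[OF Psi nu, of "(\<nu> - real CARD('n) - 1) / 2" "c / 4"] nu c by auto
  show thesis
  proof (rule that[of "b / Z" "c / 4"])
    fix x :: real
    define K where "K = exp (- (c / 4) * x) / Z"
    have K: "K \<ge> 0" using Z by (simp add: K_def)
    have "emeasure G {\<Sigma> \<in> space G. eig CARD('n) (matrix_inv \<Sigma>) \<ge> x} \<le> ennreal (b * K)"
    proof (rule b(2)[OF K])
      show "{S :: real^'n^'n. posdef S \<and> x \<le> eig CARD('n) S} \<in> sets borel"
        using borel_posdef_eig[of "CARD('n)" "{x..}", where 'n = 'n] by (simp add: Suc_leI)
      fix S :: "real^'n^'n" assume S: "posdef S" and xS: "x \<le> eig CARD('n) S"
      have "x \<le> trace S" using posdef_eig_le_trace[OF S, of "CARD('n)"] xS by (simp add: Suc_leI)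
      then have "c * x \<le> c * trace S" using c by simp
      then have "- trace (\<Psi> ** S) / 2 \<le> - (c / 4) * x + - (c / 4) * trace S"
        using c(2)[OF S] by (simp add: field_simps)
      then have "exp (- trace (\<Psi> ** S) / 2) \<le> exp (- (c / 4) * x) * exp (- (c / 4) * trace S)"
        by (simp add: exp_add[symmetric])
      then have "det S powr ((\<nu> - real CARD('n) - 1) / 2) * exp (- trace (\<Psi> ** S) / 2) / Z
        \<le> det S powr ((\<nu> - real CARD('n) - 1) / 2) * (exp (- (c / 4) * x) * exp (- (c / 4) * trace S)) / Z"
        using Z(1) by (intro divide_right_mono mult_left_mono) auto
      then show "wishart_density \<nu> (matrix_inv \<Psi>) S
        \<le> K * (det S powr ((\<nu> - real CARD('n) - 1) / 2) * exp (- (c / 4) * trace S))"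
        unfolding Z(2) K_def by (simp add: mult_ac)
    qed
    then have "measure G {\<Sigma> \<in> space G. eig CARD('n) (matrix_inv \<Sigma>) \<ge> x} \<le> b * K"
      unfolding measure_def using b(1) K by (intro enn2real_leI) auto
    then show "measure G {\<Sigma> \<in> space G. eig CARD('n) (matrix_inv \<Sigma>) \<ge> x} \<le> b / Z * exp (- (c / 4) * x)"
      by (simp add: K_def)
  qed (use b c Z in auto)
qed

text \<open>The exponent \<open>\<delta>\<close> trades the bound \<open>det S \<le> eig\<^sub>1 S * trace S ^ (d - 1)\<close> against integrability of
  \<open>det S powr (e - \<delta>)\<close>, which only needs \<open>e - \<delta> > -1\<close>.\<close>

lemma inv_wishart_lower_tail:
  fixes \<Psi> :: "real^'n^'n"
  assumes Psi: "posdef \<Psi>" and nu: "\<nu> > real CARD('n) - 1"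
  defines "G \<equiv> inv_wishart \<nu> \<Psi>"
  obtains b \<delta> where "b > 0" "\<delta> > 0"
    "\<And>x. x > 0 \<Longrightarrow> measure G {\<Sigma> \<in> space G. eig 1 (matrix_inv \<Sigma>) < x} \<le> b * x powr \<delta>"
proof -
  define e where "e = (\<nu> - real CARD('n) - 1) / 2"
  \<comment> \<open>Half the distance from \<open>e\<close> to -1, so that \<open>\<delta>\<close>
    is positive and \<open>e - \<delta>\<close> still exceeds -1.\<close>
  define \<delta> where "\<delta> = (e + 1) / 2"
  have e: "e > -1" using nu by (simp add: e_def)
  then have d: "\<delta> > 0" "e - \<delta> > -1" by (auto simp: \<delta>_def field_simps)
  obtain Z where Z: "Z > 0" "\<And>S. wishart_density \<nu> (matrix_inv \<Psi>) S =
    det S powr e * exp (- trace (\<Psi> ** S) / 2) / Z"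
    unfolding e_def using wishart_density_form[OF Psi nu] by metis
  obtain c where c: "c > 0" "\<And>S. posdef S \<Longrightarrow> c * trace S \<le> trace (\<Psi> ** S)"
    using trace_mult_posdef_lower[OF Psi] by metis
  \<comment> \<open>Half of the decay rate \<open>c / 2\<close> pays for the power of the trace that
    comes with the determinant bound.\<close>
  obtain L where L: "L > 0" "\<And>u. u > 0 \<Longrightarrow> u powr (real (CARD('n) - 1) * \<delta>) \<le> L * exp (c / 4 * u)"
    using powr_le_exp[of "real (CARD('n) - 1) * \<delta>" "c / 4"] d c by auto
  obtain b where b: "b > 0" 
    "\<And>K Q. K \<ge> 0 \<Longrightarrow> {S. posdef S \<and> Q S} \<in> sets borel \<Longrightarrow>
      (\<And>S. posdef S \<Longrightarrow> Q S \<Longrightarrow> wishart_density \<nu> (matrix_inv \<Psi>) S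
        \<le> K * (det S powr (e - \<delta>) * exp (- (c / 4) * trace S))) \<Longrightarrow>
      emeasure G {\<Sigma> \<in> space G. Q (matrix_inv \<Sigma>)} \<le> ennreal (b * K)"
    unfolding G_def
    using inv_wishart_upper_bound[OF Psi nu, of "e - \<delta>" "c / 4"] d c by auto
  show thesis
  proof (rule that[of "b * L / Z" \<delta>])
    fix x :: real assume x: "x > 0"
    define K where "K = x powr \<delta> * L / Z"
    have K: "K \<ge> 0" using Z L by (simp add: K_def)
    have "emeasure G {\<Sigma> \<in> space G. eig 1 (matrix_inv \<Sigma>) < x} \<le> ennreal (b * K)"
    proof (rule b(2)[OF K])
      show "{S :: real^'n^'n. posdef S \<and> eig 1 S < x} \<in> sets borel"
        using borel_posdef_eig[of 1 "{..<x}", where 'n = 'n] by (simp add: Suc_leI)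
      fix S :: "real^'n^'n" assume S: "posdef S" and xS: "eig 1 S < x"
      note pos = posdef_det_pos[OF S] posdef_trace_pos[OF S]
      have "det S \<le> eig 1 S * trace S ^ (CARD('n) - 1)" by (rule posdef_det_le[OF S])
      also have "\<dots> \<le> x * trace S ^ (CARD('n) - 1)"
        using xS pos by (intro mult_right_mono) auto
      finally have "det S powr \<delta> \<le> (x * trace S ^ (CARD('n) - 1)) powr \<delta>"
        using pos d by (intro powr_mono2) auto
      also have "\<dots> = x powr \<delta> * trace S powr (real (CARD('n) - 1) * \<delta>)"
        using x pos by (simp add: powr_mult powr_powr flip: powr_realpow)
      also have "\<dots> \<le> x powr \<delta> * (L * exp (c / 4 * trace S))"
        using L(2)[OF pos(2)] by (intro mult_left_mono) auto
      finally have 1: "det S powr \<delta> \<le> x powr \<delta> * (L * exp (c / 4 * trace S))" .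
      have "det S powr e * exp (- trace (\<Psi> ** S) / 2) = det S powr (e - \<delta>) * (det S powr \<delta> * exp (- trace (\<Psi> ** S) / 2))"
        using pos by (simp add: powr_diff)
      also have "\<dots> \<le> det S powr (e - \<delta>) * ((x powr \<delta> * (L * exp (c / 4 * trace S))) * exp (- (c / 2) * trace S))"
        using c(2)[OF S] 1 L(1) by (intro mult_left_mono mult_mono) auto
      also have "\<dots> = x powr \<delta> * L * (det S powr (e - \<delta>) * (exp (c / 4 * trace S) * exp (- (c / 2) * trace S)))"
        by (simp add: mult_ac)
      also have "exp (c / 4 * trace S) * exp (- (c / 2) * trace S) = exp (- (c / 4) * trace S)"
        by (simp add: exp_add[symmetric])
      finally show "wishart_density \<nu> (matrix_inv \<Psi>) S
        \<le> K * (det S powr (e - \<delta>) * exp (- (c / 4) * trace S))"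
        unfolding Z(2) K_def using Z(1) by (simp add: field_simps)
    qed
    then have "measure G {\<Sigma> \<in> space G. eig 1 (matrix_inv \<Sigma>) < x} \<le> b * K"
      unfolding measure_def using b(1) K by (intro enn2real_leI) auto
    then show "measure G {\<Sigma> \<in> space G. eig 1 (matrix_inv \<Sigma>) < x} \<le> b * L / Z * x powr \<delta>"
      by (simp add: K_def mult_ac)
  qed (use b d Z L in auto)
qed

text \<open>The sign of \<open>e\<close> decides which eigenvalue bound controls the determinant
  factor: \<open>lo\<close> from below if \<open>e \<ge> 0\<close>, \<open>hi\<close> from above
  otherwise. In the second case the power of \<open>hi\<close> is absorbed by an exponential, and
  \<open>max\<close> covers both cases with one formula.\<close>

lemma wishart_density_lower_bound:
  fixes \<Psi> :: "real^'n^'n"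
  assumes Psi: "posdef \<Psi>" and nu: "\<nu> > real CARD('n) - 1"
  obtains k a C where "k > 0" "a \<ge> 0" "C > 0"
    "\<And>S lo hi. transpose S = S \<Longrightarrow> 0 < lo \<Longrightarrow> (\<And>j. j \<in> {1..CARD('n)} \<Longrightarrow> lo \<le> eig j S \<and> eig j S \<le> hi) \<Longrightarrow>
      k * lo powr a * exp (- C * hi) \<le> wishart_density \<nu> (matrix_inv \<Psi>) S"
proof -
  define d where "d = CARD('n)"
  have d: "d > 0" by (simp add: d_def)
  define e where "e = (\<nu> - real CARD('n) - 1) / 2"
  obtain Z where Z: "Z > 0" "\<And>S. wishart_density \<nu> (matrix_inv \<Psi>) S =
    det S powr e * exp (- trace (\<Psi> ** S) / 2) / Z"
    unfolding e_def using wishart_density_form[OF Psi nu] by metis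
  obtain C where C: "C > 0" "\<And>S. posdef S \<Longrightarrow> trace (\<Psi> ** S) \<le> C * trace S"
    using trace_mult_posdef_upper[of \<Psi>] by metis
  obtain L where L: "L > 0" "\<And>u. u > 0 \<Longrightarrow> u powr (real d * max (- e) 0) \<le> L * exp (1 * u)"
    using powr_le_exp[of "real d * max (- e) 0" 1] by auto
  show thesis
  proof (rule that[of "1 / (L * Z)" "real d * max e 0" "1 + C * real d / 2"])
    show "1 / (L * Z) > 0" "real d * max e 0 \<ge> 0" "1 + C * real d / 2 > 0"
      using L Z C d by (auto intro: add_pos_nonneg)
    fix S :: "real^'n^'n" and lo hi
    assume S: "transpose S = S" and lo: "0 < lo"
      and bd: "\<And>j. j \<in> {1..CARD('n)} \<Longrightarrow> lo \<le> eig j S \<and> eig j S \<le> hi"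
    have hi: "0 < hi" "lo \<le> hi" using bd[of 1] lo by (auto simp: Suc_leI)
    have pd: "posdef S" using S bd[of 1] lo by (auto simp: posdef_iff_eig_1 Suc_leI)
    have det1: "lo ^ d \<le> det S"
    proof -
      have "(\<Prod>j=1..d. lo) \<le> (\<Prod>j=1..d. eig j S)"
        using bd lo by (intro prod_mono) (auto simp: d_def)
      then show ?thesis unfolding det_eq_prod_eig[OF S] d_def by simp
    qed
    have det2: "det S \<le> hi ^ d"
    proof -
      have "(\<Prod>j=1..d. eig j S) \<le> (\<Prod>j=1..d. hi)"
        using bd lo by (intro prod_mono) (auto simp: d_def intro: order_trans less_imp_le)
      then show ?thesis unfolding det_eq_prod_eig[OF S] d_def by simp
    qed
    have tr: "trace S \<le> real d * hi"
    proof -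
      have "(\<Sum>j=1..d. eig j S) \<le> (\<Sum>j=1..d. hi)"
        using bd by (intro sum_mono) (auto simp: d_def)
      then show ?thesis unfolding trace_eq_sum_eig[OF S] d_def by simp
    qed
    have 1: "lo powr (real d * max e 0) * (exp (- hi) / L) \<le> det S powr e"
    proof (cases "e \<ge> 0")
      case True
      \<comment> \<open>Here the exponent in the choice of \<open>L\<close> is 0, so its bound reads
        \<open>1 \<le> L * exp hi\<close> and the extra factor is harmless.\<close>
      have "1 \<le> L * exp hi" using L(2)[OF hi(1)] True hi by (simp add: max_def split: if_splits)
      then have "exp (- hi) / L \<le> 1" using L(1) by (simp add: exp_minus field_simps)
      then have "lo powr (real d * max e 0) * (exp (- hi) / L) \<le> lo powr (real d * e) * 1"
        using True by (intro mult_mono) (use L in auto)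
      also have "\<dots> = (lo ^ d) powr e" using lo by (simp add: powr_powr flip: powr_realpow)
      also have "\<dots> \<le> det S powr e" using det1 lo True by (intro powr_mono2) auto
      finally show ?thesis .
    next
      case False
      have "exp (- hi) / L \<le> hi powr (real d * e)"
      proof -
        have "hi powr (- (real d * e)) \<le> L * exp hi" using L(2)[OF hi(1)] False by simp
        then have "1 \<le> L * exp hi * hi powr (real d * e)" using hi by (simp add: powr_minus field_simps)
        then show ?thesis using L(1) by (simp add: exp_minus field_simps)
      qed
      also have "\<dots> = (hi ^ d) powr e" using hi by (simp add: powr_powr flip: powr_realpow)
      also have "\<dots> \<le> det S powr e"
        using det2 False posdef_det_pos[OF pd] by (intro powr_mono2') auto
      finally show ?thesis using False lo by simp
    qed
    have "trace (\<Psi> ** S) \<le> C * (real d * hi)"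
      using C(2)[OF pd] mult_left_mono[OF tr, of C] C(1) by linarith
    then have 2: "exp (- (C * real d / 2) * hi) \<le> exp (- trace (\<Psi> ** S) / 2)" by (simp add: mult_ac)
    have "1 / (L * Z) * lo powr (real d * max e 0) * exp (- (1 + C * real d / 2) * hi)
      = (lo powr (real d * max e 0) * (exp (- hi) / L)) * exp (- (C * real d / 2) * hi) / Z"
      by (simp add: exp_add[symmetric] algebra_simps)
    also have "\<dots> \<le> det S powr e * exp (- trace (\<Psi> ** S) / 2) / Z"
      using 1 2 Z L by (intro divide_right_mono mult_mono) auto
    finally show "1 / (L * Z) * lo powr (real d * max e 0) * exp (- (1 + C * real d / 2) * hi)
      \<le> wishart_density \<nu> (matrix_inv \<Psi>) S" unfolding Z(2) .
  qed
qed

section \<open>The window event around a diagonal matrix\<close>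

lemma eigenbasis_diagmat:
  fixes l :: "'n::finite \<Rightarrow> real"
  shows "eigenbasis (diagmat l) (\<lambda>i. axis i 1) l"
proof -
  have "(diagmat l *v axis i 1) $ k = (l i *\<^sub>R axis i 1) $ k" for i k :: 'n
    unfolding matrix_vector_mult_basis column_def diagmat_def by (auto simp: axis_def)
  then show ?thesis
    by (auto simp: eigenbasis_def inner_axis_axis vec_eq_iff)
qed

text \<open>The diagonal centre has its eigenvalues at the midpoints of the windows, at distance
  \<open>s j * t / 2\<close> from both ends, while the perturbation moves them by at most
  \<open>s 1 * t / 4\<close>. The bijection \<open>b\<close> places the numbered values on the
  unordered index type.\<close>

lemma eig_in_window_of_near_diagonal:
  fixes S :: "real^'n^'n"
  assumes S: "transpose S = S" and b: "bij_betw b {1..CARD('n)} (UNIV :: 'n set)"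
    and s1: "0 < s 1" and mono: "\<And>i j. 1 \<le> i \<Longrightarrow> i \<le> j \<Longrightarrow> j \<le> CARD('n) \<Longrightarrow> s i \<le> s j"
    and t: "0 < t"
    and near: "\<And>i k. \<bar>S $ i $ k - diagmat (\<lambda>i. s (inv_into {1..CARD('n)} b i) * (1 + t / 2)) $ i $ k\<bar>
      \<le> s 1 * t / (4 * (real CARD('n))\<^sup>2)"
    and j: "j \<in> {1..CARD('n)}"
  shows "s j < eig j S \<and> eig j S < s j * (1 + t)"
proof -
  let ?l = "\<lambda>i. s (inv_into {1..CARD('n)} b i) * (1 + t / 2)"
  have lb: "?l (b i) = s i * (1 + t / 2)" if "i \<in> {1..CARD('n)}" for i
    using bij_betw_inv_into_left[OF b that] by simp
  have sym: "transpose (diagmat ?l) = diagmat ?l" by (auto simp: vec_eq_iff transpose_def diagmat_def)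
  have "eig j (diagmat ?l) = ?l (b j)"
  proof (rule eig_eq_sorted[OF eigenbasis_diagmat b _ j])
    fix i k assume ik: "1 \<le> i" "i \<le> k" "k \<le> CARD('n)"
    have "s i * (1 + t / 2) \<le> s k * (1 + t / 2)" using mono[OF ik] t by (intro mult_right_mono) auto
    moreover have "?l (b i) = s i * (1 + t / 2)" "?l (b k) = s k * (1 + t / 2)"
      using ik by (intro lb; simp)+
    ultimately show "?l (b i) \<le> ?l (b k)" by (simp only:)
  qed
  then have e0: "eig j (diagmat ?l) = s j * (1 + t / 2)" using lb[OF j] by simp
  have "\<bar>eig j S - eig j (diagmat ?l)\<bar> \<le> (real CARD('n))\<^sup>2 * (s 1 * t / (4 * (real CARD('n))\<^sup>2))"
    by (rule eig_Lipschitz_entries[OF S sym near j])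
  also have "\<dots> = s 1 * t / 4" by simp
  finally have "\<bar>eig j S - s j * (1 + t / 2)\<bar> \<le> s 1 * t / 4" by (simp only: e0)
  moreover have "s 1 * t \<le> s j * t" "0 < s 1 * t" using mono[of 1 j] j t s1 by (auto intro: mult_right_mono)
  ultimately show ?thesis unfolding distrib_left mult_1_right by linarith
qed

text \<open>The probability is at least the density bound times the volume of a cube in the
  \<open>N\<close> free coordinates. The exponent of \<open>s 1\<close> collects \<open>a\<close>
  from the density and \<open>N\<close> from the volume, and \<open>t\<close> enters through the
  volume only.\<close>

lemma inv_wishart_window:
  fixes \<Psi> :: "real^'n^'n"
  assumes Psi: "posdef \<Psi>" and nu: "\<nu> > real CARD('n) - 1"
  defines "G \<equiv> inv_wishart \<nu> \<Psi>"
  obtains b a n C where "b > 0" "a > 0" "n > 0" "C > 0"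
    "\<And>s t. 0 < s 1 \<and> (\<forall>i j. 1 \<le> i \<and> i \<le> j \<and> j \<le> CARD('n) \<longrightarrow> s i \<le> s j) \<and> 0 < t \<and> t < 1 \<Longrightarrow>
      b * s 1 powr a * t powr n * exp (- C * s CARD('n)) \<le>
      measure G {\<Sigma> \<in> space G. \<forall>j\<in>{1..CARD('n)}. s j < eig j (matrix_inv \<Sigma>) \<and> eig j (matrix_inv \<Sigma>) < s j * (1 + t)}"
proof -
  let ?d = "CARD('n)"
  let ?I = "{{i, j} | i j :: 'n. True}"
  let ?M = "\<Pi>\<^sub>M p\<in>?I. (lborel :: real measure)"
  interpret P: product_sigma_finite "\<lambda>p :: 'n set. (lborel :: real measure)" by standard
  define N where "N = card ?I"
  have finI: "finite ?I" by simp
  have "?I \<noteq> {}" by auto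
  then have N: "N > 0" unfolding N_def using finI by (simp add: card_gt_0_iff)
  obtain k a C where k: "k > 0" "a \<ge> 0" "C > 0"
    "\<And>S lo hi. transpose S = S \<Longrightarrow> 0 < lo \<Longrightarrow> (\<And>j. j \<in> {1..?d} \<Longrightarrow> lo \<le> eig j S \<and> eig j S \<le> hi) \<Longrightarrow>
      k * lo powr a * exp (- C * hi) \<le> wishart_density \<nu> (matrix_inv \<Psi>) S"
    using wishart_density_lower_bound[OF Psi nu] by metis
  obtain Z where Z: "Z > 0" "\<And>S. wishart_density \<nu> (matrix_inv \<Psi>) S =
    det S powr ((\<nu> - real CARD('n) - 1) / 2) * exp (- trace (\<Psi> ** S) / 2) / Z"
    using wishart_density_form[OF Psi nu] by metis
  obtain c where c: "c > 0" "\<And>S. posdef S \<Longrightarrow> c * trace S \<le> trace (\<Psi> ** S)"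
    using trace_mult_posdef_lower[OF Psi] by metis
  obtain B where B: "B > 0" 
    "\<And>K Q. K \<ge> 0 \<Longrightarrow> {S. posdef S \<and> Q S} \<in> sets borel \<Longrightarrow>
      (\<And>S. posdef S \<Longrightarrow> Q S \<Longrightarrow> wishart_density \<nu> (matrix_inv \<Psi>) S
        \<le> K * (det S powr ((\<nu> - real CARD('n) - 1) / 2) * exp (- (c / 2) * trace S))) \<Longrightarrow>
      emeasure G {\<Sigma> \<in> space G. Q (matrix_inv \<Sigma>)} \<le> ennreal (B * K)"
    unfolding G_def
    using inv_wishart_upper_bound[OF Psi nu, of "(\<nu> - real CARD('n) - 1) / 2" "c / 2"] nu c by auto
  obtain b :: "nat \<Rightarrow> 'n" where b: "bij_betw b {1..?d} UNIV"
    using ex_bij_betw_nat_finite_1[of "UNIV :: 'n set"] by auto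
  show thesis
  \<comment> \<open>The side of the cube is \<open>s 1 * t / (2 * d\<^sup>2)\<close> with
    \<open>d = CARD('n)\<close>, which gives the first constant; \<open>2 * C\<close> appears
    because \<open>t < 1\<close> bounds all eigenvalues in the windows by twice the largest
    \<open>s j\<close>.\<close>
  proof (rule that[of "k * (1 / (2 * (real ?d)\<^sup>2)) ^ N" "a + real N" "real N" "2 * C"])
    show "k * (1 / (2 * (real ?d)\<^sup>2)) ^ N > 0" "a + real N > 0" "real N > 0" "2 * C > 0"
      using k N by (auto intro: add_nonneg_pos)
    fix s :: "nat \<Rightarrow> real" and t :: real
    assume st: "0 < s 1 \<and> (\<forall>i j. 1 \<le> i \<and> i \<le> j \<and> j \<le> ?d \<longrightarrow> s i \<le> s j) \<and> 0 < t \<and> t < 1"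
    then have s1: "0 < s 1" and t: "0 < t" "t < 1" by auto
    have mono: "s i \<le> s j" if "1 \<le> i" "i \<le> j" "j \<le> ?d" for i j using st that by blast
    define Q where "Q = (\<lambda>S :: real^'n^'n. \<forall>j\<in>{1..?d}. s j < eig j S \<and> eig j S < s j * (1 + t))"
    define l where "l = (\<lambda>i. s (inv_into {1..?d} b i) * (1 + t / 2))"
    \<comment> \<open>The centre of the cube as a function of unordered pairs: singletons are the
      diagonal positions, all other pairs get 0.\<close>
    define m where "m = (\<lambda>p. if \<exists>i. p = {i} then l (THE i. p = {i}) else 0)"
    have m: "m {i, j} = diagmat l $ i $ j" for i j
    proof (cases "i = j")
      case True
      then show ?thesis by (auto simp: m_def diagmat_def)
    next
      case False
      then have "\<not> (\<exists>k. {i, j} = {k})" by auto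
      with False show ?thesis by (simp add: m_def diagmat_def)
    qed
    define r where "r = s 1 * t / (4 * (real ?d)\<^sup>2)"
    have r: "r > 0" using s1 t by (simp add: r_def)
    define cube where "cube = Pi\<^sub>E ?I (\<lambda>p. {m p - r<..<m p + r})"
    define low where "low = k * s 1 powr a * exp (- C * (2 * s ?d))"
    have low: "low \<ge> 0" using k by (simp add: low_def)
    have cubeM: "cube \<in> sets ?M" unfolding cube_def by (rule sets_PiM_I_finite) auto
    have "emeasure ?M cube = (\<Prod>p\<in>?I. emeasure lborel {m p - r<..<m p + r})"
      unfolding cube_def by (rule P.emeasure_PiM) auto
    also have "\<dots> = ennreal ((2 * r) ^ N)"
      using r by (simp add: N_def ennreal_power)
    finally have vol: "emeasure ?M cube = ennreal ((2 * r) ^ N)" .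
    have cube: "posdef S \<and> Q S \<and> low \<le> wishart_density \<nu> (matrix_inv \<Psi>) S"
      if f: "f \<in> cube" and Sf: "S = (\<chi> i j. f {i, j})" for f and S :: "real^'n^'n"
    proof -
      have S: "transpose S = S" by (simp add: Sf vec_eq_iff transpose_def insert_commute)
      have near: "\<bar>S $ i $ j - diagmat l $ i $ j\<bar> \<le> r" for i j
      proof -
        have "f {i, j} \<in> {m {i, j} - r<..<m {i, j} + r}"
          using f unfolding cube_def by (rule PiE_mem) auto
        then show ?thesis unfolding m Sf by (simp add: abs_le_iff)
      qed
      have w: "s j < eig j S \<and> eig j S < s j * (1 + t)" if "j \<in> {1..?d}" for j
        by (rule eig_in_window_of_near_diagonal[OF S b s1 mono t(1) near[unfolded l_def r_def] that])
      have "s 1 \<le> eig j S \<and> eig j S \<le> 2 * s ?d" if j: "j \<in> {1..?d}" for j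
      proof -
        have "s 1 \<le> s j" "s j \<le> s ?d" using mono j by auto
        moreover have "s j * (1 + t) \<le> s j * 2" using \<open>s 1 \<le> s j\<close> s1 t by (intro mult_left_mono) auto
        ultimately show ?thesis using w[OF j] by linarith
      qed
      then have "low \<le> wishart_density \<nu> (matrix_inv \<Psi>) S" unfolding low_def by (rule k(4)[OF S s1])
      moreover have "posdef S" using S w[of 1] s1 by (simp add: posdef_iff_eig_1 Suc_leI)
      ultimately show ?thesis using w by (simp add: Q_def)
    qed
    have Qm: "{S. posdef S \<and> Q S} \<in> sets borel"
    proof -
      have "{S. posdef S \<and> Q S} = {S. posdef S} \<inter> (\<Inter>j\<in>{1..?d}. {S. posdef S \<and> eig j S \<in> {s j<..<s j * (1 + t)}})"
        by (auto simp: Q_def)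
      also have "\<dots> \<in> sets borel"
        by (intro sets.Int borel_posdef sets.finite_INT borel_posdef_eig) (auto simp: Suc_leI)
      finally show ?thesis .
    qed
    \<comment> \<open>\<open>measure\<close> sends an infinite value to 0, so finiteness is required
      before a lower bound on \<open>emeasure\<close> transfers to it.\<close>
    have fin: "emeasure G {\<Sigma> \<in> space G. Q (matrix_inv \<Sigma>)} < \<infinity>"
    proof -
      have "emeasure G {\<Sigma> \<in> space G. Q (matrix_inv \<Sigma>)} \<le> ennreal (B * (1 / Z))"
      proof (rule B(2)[OF _ Qm])
        fix S :: "real^'n^'n" assume S: "posdef S"
        show "wishart_density \<nu> (matrix_inv \<Psi>) S
          \<le> 1 / Z * (det S powr ((\<nu> - real CARD('n) - 1) / 2) * exp (- (c / 2) * trace S))"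
          unfolding Z(2) using c(2)[OF S] Z(1) by (simp add: divide_right_mono mult_left_mono)
      qed (use Z in simp)
      also have "\<dots> < \<infinity>" by simp
      finally show ?thesis .
    qed
    have "ennreal (low * (2 * r) ^ N) = (\<integral>\<^sup>+ f. ennreal low * indicator cube f \<partial>?M)"
      by (simp only: nn_integral_cmult_indicator[OF cubeM] vol ennreal_mult'[OF low])
    also have "\<dots> \<le> (\<integral>\<^sup>+ f. ennreal (indicator {S. posdef S \<and> Q S} (\<chi> i j. f {i, j}) *
        wishart_density \<nu> (matrix_inv \<Psi>) (\<chi> i j. f {i, j})) \<partial>?M)"
    proof (intro nn_integral_mono)
      fix f :: "'n set \<Rightarrow> real"
      show "ennreal low * indicator cube f \<le> ennreal (indicator {S. posdef S \<and> Q S} (\<chi> i j. f {i, j}) *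
        wishart_density \<nu> (matrix_inv \<Psi>) (\<chi> i j. f {i, j}))"
        using cube[OF _ refl, of f] by (cases "f \<in> cube") (auto intro: ennreal_leI)
    qed
    also have "\<dots> = (\<integral>\<^sup>+ S. ennreal (indicator {S. posdef S \<and> Q S} S * wishart_density \<nu> (matrix_inv \<Psi>) S) \<partial>sym_lborel)"
      using Qm by (subst nn_integral_sym_lborel) auto
    also have "\<dots> = emeasure G {\<Sigma> \<in> space G. Q (matrix_inv \<Sigma>)}"
      unfolding G_def by (rule emeasure_inv_wishart[OF Psi nu Qm, symmetric])
    finally have "low * (2 * r) ^ N \<le> measure G {\<Sigma> \<in> space G. Q (matrix_inv \<Sigma>)}"
      using fin low r by (simp add: emeasure_eq_ennreal_measure ennreal_le_iff)
    moreover have "low * (2 * r) ^ N =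
      k * (1 / (2 * (real ?d)\<^sup>2)) ^ N * s 1 powr (a + real N) * t powr real N * exp (- (2 * C) * s ?d)"
    proof -
      have "2 * r = (1 / (2 * (real ?d)\<^sup>2)) * s 1 * t" by (simp add: r_def)
      then have "(2 * r) ^ N = (1 / (2 * (real ?d)\<^sup>2)) ^ N * s 1 powr real N * t powr real N"
        using s1 t by (simp only: power_mult_distrib powr_realpow)
      then show ?thesis unfolding low_def by (simp add: powr_add mult_ac)
    qed
    ultimately show "k * (1 / (2 * (real ?d)\<^sup>2)) ^ N * s 1 powr (a + real N) * t powr real N * exp (- (2 * C) * s ?d)
      \<le> measure G {\<Sigma> \<in> space G. \<forall>j\<in>{1..?d}. s j < eig j (matrix_inv \<Sigma>) \<and> eig j (matrix_inv \<Sigma>) < s j * (1 + t)}"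
      unfolding Q_def by simp
  qed
qed

theorem lemma1:
  fixes \<nu> \<kappa> :: real
    and \<Psi> :: "real^'n^'n"
    and d :: nat
    and G :: "(real^'n^'n) measure"
  assumes d: "d = CARD('n)"
    and nu: "\<nu> > real d - 1"
    and Psi: "posdef \<Psi>"
    and G: "G = inv_wishart \<nu> \<Psi>"
    and kappa: "\<kappa> = 2"
  shows "\<exists>a\<^sub>2 a\<^sub>3 a\<^sub>4 a\<^sub>5 b\<^sub>2 b\<^sub>3 b\<^sub>4 C\<^sub>2 C\<^sub>3 :: real.
     a\<^sub>2 > 0 \<and> a\<^sub>3 > 0 \<and> a\<^sub>4 > 0 \<and> a\<^sub>5 > 0 \<and>
     b\<^sub>2 > 0 \<and> b\<^sub>3 > 0 \<and> b\<^sub>4 > 0 \<and> C\<^sub>2 > 0 \<and> C\<^sub>3 > 0 \<and>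
     (\<forall>\<^sub>F x in at_top.
        measure G {\<Sigma> \<in> space G. eig d (matrix_inv \<Sigma>) \<ge> x} \<le> b\<^sub>2 * exp (- C\<^sub>2 * x powr a\<^sub>2)) \<and>
     (\<forall>\<^sub>F x in at_right 0.
        measure G {\<Sigma> \<in> space G. eig 1 (matrix_inv \<Sigma>) < x} \<le> b\<^sub>3 * x powr a\<^sub>3) \<and>
     (\<forall>(s :: nat \<Rightarrow> real) t :: real.
        0 < s 1 \<and> (\<forall>i j. 1 \<le> i \<and> i \<le> j \<and> j \<le> d \<longrightarrow> s i \<le> s j) \<and> 0 < t \<and> t < 1 \<longrightarrow>
        measure G {\<Sigma> \<in> space G.
            \<forall>j\<in>{1..d}. s j < eig j (matrix_inv \<Sigma>) \<and> eig j (matrix_inv \<Sigma>) < s j * (1 + t)}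
          \<ge> b\<^sub>4 * s 1 powr a\<^sub>4 * t powr a\<^sub>5 * exp (- C\<^sub>3 * s d powr (\<kappa> / 2)))"
proof -
  have nu': "\<nu> > real CARD('n) - 1" using nu d by simp
  obtain b2 C2 where i: "b2 > 0" "C2 > 0"
    "\<And>x. measure G {\<Sigma> \<in> space G. eig d (matrix_inv \<Sigma>) \<ge> x} \<le> b2 * exp (- C2 * x)"
    by (rule inv_wishart_upper_tail[OF Psi nu', folded d G]) (rule that)
  obtain b3 a3 where ii: "b3 > 0" "a3 > 0"
    "\<And>x. x > 0 \<Longrightarrow> measure G {\<Sigma> \<in> space G. eig 1 (matrix_inv \<Sigma>) < x} \<le> b3 * x powr a3"
    by (rule inv_wishart_lower_tail[OF Psi nu', folded G]) (rule that)
  obtain b4 a4 a5 C3 where iii: "b4 > 0" "a4 > 0" "a5 > 0" "C3 > 0"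
    "\<And>s t. 0 < s 1 \<and> (\<forall>i j. 1 \<le> i \<and> i \<le> j \<and> j \<le> d \<longrightarrow> s i \<le> s j) \<and> 0 < t \<and> t < 1 \<Longrightarrow>
      b4 * s 1 powr a4 * t powr a5 * exp (- C3 * s d) \<le>
      measure G {\<Sigma> \<in> space G. \<forall>j\<in>{1..d}. s j < eig j (matrix_inv \<Sigma>) \<and> eig j (matrix_inv \<Sigma>) < s j * (1 + t)}"
    by (rule inv_wishart_window[OF Psi nu', folded d G]) (rule that)
  show ?thesis
  proof (intro exI conjI)
    \<comment> \<open>The exponent is 1, and \<open>x powr 1\<close> equals \<open>x\<close> once
      \<open>x\<close> is positive.\<close>
    show "\<forall>\<^sub>F x in at_top. measure G {\<Sigma> \<in> space G. eig d (matrix_inv \<Sigma>) \<ge> x} \<le> b2 * exp (- C2 * x powr 1)"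
      using eventually_gt_at_top[of 0] by eventually_elim (use i(3) in simp)
    show "\<forall>\<^sub>F x in at_right 0. measure G {\<Sigma> \<in> space G. eig 1 (matrix_inv \<Sigma>) < x} \<le> b3 * x powr a3"
      using eventually_at_right_less[of 0] by eventually_elim (use ii(3) in simp)
    show "\<forall>s t. 0 < s 1 \<and> (\<forall>i j. 1 \<le> i \<and> i \<le> j \<and> j \<le> d \<longrightarrow> s i \<le> s j) \<and> 0 < t \<and> t < 1 \<longrightarrow>
        measure G {\<Sigma> \<in> space G.
            \<forall>j\<in>{1..d}. s j < eig j (matrix_inv \<Sigma>) \<and> eig j (matrix_inv \<Sigma>) < s j * (1 + t)}
          \<ge> b4 * s 1 powr a4 * t powr a5 * exp (- C3 * s d powr (\<kappa> / 2))"
    proof (intro allI impI)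
      fix s :: "nat \<Rightarrow> real" and t :: real
      assume st: "0 < s 1 \<and> (\<forall>i j. 1 \<le> i \<and> i \<le> j \<and> j \<le> d \<longrightarrow> s i \<le> s j) \<and> 0 < t \<and> t < 1"
      have "1 \<le> d" using d by (simp add: Suc_leI)
      then have "s 1 \<le> s d" using st by blast
      \<comment> \<open>With \<open>\<kappa> = 2\<close> the exponent is 1, and \<open>s d\<close>
        is positive because it is at least \<open>s 1\<close>.\<close>
      then have "s d powr (\<kappa> / 2) = s d" using st kappa by simp
      then show "measure G {\<Sigma> \<in> space G.
            \<forall>j\<in>{1..d}. s j < eig j (matrix_inv \<Sigma>) \<and> eig j (matrix_inv \<Sigma>) < s j * (1 + t)}
          \<ge> b4 * s 1 powr a4 * t powr a5 * exp (- C3 * s d powr (\<kappa> / 2))"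
        using iii(5)[OF st] by simp
    qed
  qed (use i ii iii in simp_all)
qed

end
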